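(* Let $t\ge 1$, $k\geq t+2$ and let $\mathcal{F}$ be a $t$-intersecting family of $k$-partitions of $[n]$. If $n\geq t+1+(k-t-1)\log_2(2ek+1)$, then $$|\mathcal{F}|\leq S(n-t,k-t).$$ Moreover, equality holds precisely if $\mathcal{F}$ consists of all $k$-partitions of $[n]$ having $t$ fixed singletons as blocks.
   Context: $[n]=\{1,\dots,n\}$ and $e$ is the base of the natural logarithm. A $k$-partition of $[n]$ is a collection of $k$ pairwise disjoint non-empty subsets (blocks) of $[n]$ whose union is $[n]$. A family of $k$-partitions of $[n]$ is $t$-intersecting if any two of its members share at least $t$ blocks. $S(m,j)$ denotes the Stirling number of the second kind, i.e. the number of $j$-partitions of $[m]$; thus $S(n-t,k-t)=\frac{1}{(k-t)!}\sum_{j=0}^{k-t}(-1)^j\binom{k-t}{j}(k-t-j)^{n-t}$. *)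

theory Defs
  imports Complex_Main "HOL-Library.Disjoint_Sets" "HOL-Combinatorics.Stirling"
begin

text \<open>Only used for finite \<open>A\<close>, where every partition of \<open>A\<close> is finite.\<close>

definition kpartitions :: "nat \<Rightarrow> 'a set \<Rightarrow> 'a set set set" where
  "kpartitions k A = {P. partition_on A P \<and> card P = k}"

text \<open>The condition is imposed on pairs of distinct members; a member that is a
  \<open>k\<close>-partition with \<open>t \<le> k\<close> shares at least \<open>t\<close> blocks with itself anyway.\<close>

definition t_intersecting :: "nat \<Rightarrow> 'a set set set \<Rightarrow> bool" where
  "t_intersecting t F \<longleftrightarrow> pairwise (\<lambda>P Q. t \<le> card (P \<inter> Q)) F"

definition singleton_star :: "nat \<Rightarrow> 'a set \<Rightarrow> 'a set \<Rightarrow> 'a set set set" where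
  "singleton_star k A T = {P \<in> kpartitions k A. \<forall>x\<in>T. {x} \<in> P}"

text \<open>The library defines \<open>Stirling\<close> by its recurrence; the rest of this theory shows that it
  counts partitions.\<close>

lemma finite_kpartitions: "finite A \<Longrightarrow> finite (kpartitions k A)"
  unfolding kpartitions_def
  by (rule finite_subset[OF _ finitely_many_partition_on[of A]]) auto

lemma kpartitions_0: "kpartitions k {} = (if k = 0 then {{}} else {})"
  by (auto simp: kpartitions_def partition_on_empty)

lemma finite_kpartition: "finite A \<Longrightarrow> P \<in> kpartitions k A \<Longrightarrow> finite P"
  unfolding kpartitions_def partition_on_def by (auto dest: finite_UnionD)

lemma kpartitions_insert:
  assumes A: "finite A" "a \<notin> A"
  shows "kpartitions (Suc k) (insert a A) =
    insert {a} ` kpartitions k A \<union>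
    (\<lambda>(P, B). insert (insert a B) (P - {B})) ` (SIGMA P:kpartitions (Suc k) A. P)"
    (is "?L = ?R1 \<union> ?R2")
proof (intro equalityI subsetI)
  fix P assume P: "P \<in> ?L"
  then have pP: "partition_on (insert a A) P" and cP: "card P = Suc k"
    by (auto simp: kpartitions_def)
  have finP: "finite P" using finite_kpartition[OF _ P] A by simp
  obtain C where C: "C \<in> P" "a \<in> C"
    using pP by (auto simp: partition_on_def)
  have uniq: "D = C" if "D \<in> P" "a \<in> D" for D
    using pP C that by (auto simp: partition_on_def disjoint_def)
  have dis: "D \<inter> E = {}" if "D \<in> P" "E \<in> P" "D \<noteq> E" for D E
    using pP that by (auto simp: partition_on_def disjoint_def)
  have U: "\<Union>P = insert a A" and ne: "{} \<notin> P"
    using pP by (auto simp: partition_on_def)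
  have UC: "\<Union>(P - {C}) \<union> C = insert a A" using U C by blast
  have nU: "a \<notin> \<Union>(P - {C})" using uniq by blast
  have split: "\<Union>(P - {C}) \<union> (C - {a}) = A"
  proof -
    have "\<Union>(P - {C}) \<union> (C - {a}) = (\<Union>(P - {C}) \<union> C) - {a}"
      using nU by (simp add: Un_Diff)
    also have "\<dots> = A" unfolding UC using A(2) by simp
    finally show ?thesis .
  qed
  show "P \<in> ?R1 \<union> ?R2"
  proof (cases "C = {a}")
    case True
    have "\<Union>(P - {C}) = A"
      using split True by simp
    moreover have "disjoint (P - {C})" using dis by (auto simp: disjoint_def)
    ultimately have "P - {C} \<in> kpartitions k A"
      using cP C finP ne by (auto simp: kpartitions_def partition_on_def)
    moreover have "P = insert {a} (P - {C})" using C True by auto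
    ultimately show ?thesis by blast
  next
    case False
    define B where "B = C - {a}"
    define Q where "Q = insert B (P - {C})"
    have Bne: "B \<noteq> {}" using False C by (auto simp: B_def)
    have BnP: "B \<notin> P"
    proof
      assume "B \<in> P"
      moreover have "B \<noteq> C" using C by (auto simp: B_def)
      ultimately have "B \<inter> C = {}" using dis C by blast
      with Bne show False by (auto simp: B_def)
    qed
    have "\<Union>(P - {C}) \<union> B = A" using split by (simp add: B_def)
    then have "\<Union>Q = A" by (simp add: Q_def Un_commute)
    moreover have "disjoint Q"
      unfolding disjoint_def
    proof (intro ballI impI)
      fix D E assume DE: "D \<in> Q" "E \<in> Q" "D \<noteq> E"
      have "B \<inter> D = {}" if "D \<in> P - {C}" for D
        using dis[of C D] C that by (auto simp: B_def)
      with DE dis show "D \<inter> E = {}" unfolding Q_def by blast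
    qed
    moreover have "{} \<notin> Q" using ne Bne by (auto simp: Q_def)
    moreover have "card Q = Suc k"
      using finP BnP C cP by (simp add: Q_def)
    ultimately have "Q \<in> kpartitions (Suc k) A"
      by (auto simp: kpartitions_def partition_on_def)
    then have "(Q, B) \<in> (SIGMA P:kpartitions (Suc k) A. P)" by (simp add: Q_def)
    moreover have "insert a B = C" using C(2) by (auto simp: B_def)
    moreover have "Q - {B} = P - {C}" using BnP by (auto simp: Q_def)
    ultimately have "P \<in> ?R2"
      using C(1) by (intro image_eqI[where x = "(Q, B)"]) (simp_all add: insert_absorb)
    then show ?thesis by blast
  qed
next
  fix P assume "P \<in> ?R1 \<union> ?R2"
  then show "P \<in> ?L"
  proof
    assume "P \<in> ?R1"
    then obtain Q where Q: "Q \<in> kpartitions k A" "P = insert {a} Q" by auto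
    have "{a} \<notin> Q" using Q(1) A by (auto simp: kpartitions_def partition_on_def)
    then show ?thesis
      using Q A finite_kpartition[OF A(1) Q(1)]
      by (auto simp: kpartitions_def partition_on_def disjoint_def)
  next
    assume "P \<in> ?R2"
    then obtain Q B where Q: "Q \<in> kpartitions (Suc k) A" "B \<in> Q"
      and P: "P = insert (insert a B) (Q - {B})" by auto
    have finQ: "finite Q" using finite_kpartition[OF A(1) Q(1)] .
    have U: "\<Union>Q = A" and ne: "{} \<notin> Q" and c: "card Q = Suc k"
      and dis: "\<And>D E. D \<in> Q \<Longrightarrow> E \<in> Q \<Longrightarrow> D \<noteq> E \<Longrightarrow> D \<inter> E = {}"
      using Q(1) by (auto simp: kpartitions_def partition_on_def disjoint_def)
    have na: "a \<notin> D" if "D \<in> Q" for D using U A that by auto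
    have "insert a B \<notin> Q" using na by auto
    then have "card P = Suc k"
      using finQ Q(2) c by (simp add: P)
    moreover have "\<Union>P = insert a A" using U Q(2) unfolding P by blast
    moreover have "{} \<notin> P" using ne by (auto simp: P)
    moreover have "disjoint P"
      unfolding disjoint_def
    proof (intro ballI impI)
      fix D E assume DE: "D \<in> P" "E \<in> P" "D \<noteq> E"
      have "insert a B \<inter> D = {}" if "D \<in> Q - {B}" for D
        using dis[of B D] Q(2) na that by auto
      with DE dis show "D \<inter> E = {}" unfolding P by blast
    qed
    ultimately show ?thesis by (auto simp: kpartitions_def partition_on_def)
  qed
qed

lemma card_kpartitions:
  assumes "finite A"
  shows "card (kpartitions k A) = Stirling (card A) k"
  using assms
proof (induction A arbitrary: k rule: finite_induct)
  case empty
  show ?case by (cases k) (auto simp: kpartitions_0)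
next
  case (insert a A)
  show ?case
  proof (cases k)
    case 0
    have "P = {}" if "P \<in> kpartitions 0 (insert a A)" for P
      using finite_kpartition[OF _ that] insert.hyps that by (auto simp: kpartitions_def)
    then have "kpartitions 0 (insert a A) = {}"
      by (auto simp: kpartitions_def partition_on_def)
    with 0 insert.hyps show ?thesis by simp
  next
    case (Suc j)
    let ?f = "\<lambda>(P, B). insert (insert a B) (P - {B})"
    let ?X = "SIGMA P:kpartitions (Suc j) A. P"
    have na: "a \<notin> D" if "P \<in> kpartitions i A" "D \<in> P" for P D i
      using that insert.hyps by (auto simp: kpartitions_def partition_on_def)
    have inj1: "inj_on (insert {a}) (kpartitions j A)"
      using na by (intro inj_onI) (metis insert_ident singletonI)
    have inj2: "inj_on ?f ?X"
    proof (rule inj_onI, clarify)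
      fix P B Q C
      assume PQ: "P \<in> kpartitions (Suc j) A" "B \<in> P" "Q \<in> kpartitions (Suc j) A" "C \<in> Q"
        and eq: "insert (insert a B) (P - {B}) = insert (insert a C) (Q - {C})"
      have "insert a B \<in> insert (insert a C) (Q - {C})" using eq by blast
      then have "insert a B = insert a C" using na[OF PQ(3)] by blast
      then have BC: "B = C" using na[OF PQ(1,2)] na[OF PQ(3,4)] by (metis insert_ident)
      have "P - {B} = Q - {C}"
        using eq BC na[OF PQ(1)] na[OF PQ(3)] by (metis Diff_iff insertI1 insert_ident)
      with BC PQ show "P = Q \<and> B = C" by blast
    qed
    have disj: "insert {a} ` kpartitions j A \<inter> ?f ` ?X = {}"
    proof -
      have False if P: "P \<in> kpartitions j A" and Q: "Q \<in> kpartitions (Suc j) A" "B \<in> Q"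
        and eq: "insert {a} P = insert (insert a B) (Q - {B})" for P Q B
      proof -
        have "{a} \<in> insert (insert a B) (Q - {B})" using eq by blast
        then have "{a} = insert a B" using na[OF Q(1)] by blast
        then have "B = {}" using na[OF Q] by blast
        with Q show False by (auto simp: kpartitions_def partition_on_def)
      qed
      then show ?thesis by auto
    qed
    have finX: "finite ?X"
      using finite_kpartitions[OF insert.hyps(1)] finite_kpartition[OF insert.hyps(1)] by blast
    have "card ?X = (\<Sum>P\<in>kpartitions (Suc j) A. card P)"
      using finite_kpartitions[OF insert.hyps(1)] finite_kpartition[OF insert.hyps(1)]
      by (subst card_SigmaI) auto
    also have "\<dots> = (\<Sum>P\<in>kpartitions (Suc j) A. Suc j)"
      by (rule sum.cong) (auto simp: kpartitions_def)
    finally have cX: "card ?X = Suc j * Stirling (card A) (Suc j)"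
      by (simp add: insert.IH)
    have "card (kpartitions (Suc j) (insert a A)) =
        card (insert {a} ` kpartitions j A) + card (?f ` ?X)"
      unfolding kpartitions_insert[OF insert.hyps]
      by (rule card_Un_disjoint) (use finX finite_kpartitions[OF insert.hyps(1)] disj in auto)
    also have "\<dots> = Stirling (card A) j + Suc j * Stirling (card A) (Suc j)"
      by (simp add: card_image inj1 inj2 insert.IH cX del: mult_Suc)
    finally show ?thesis using Suc insert.hyps by simp
  qed
qed

corollary Stirling_eq_card: "Stirling m j = card (kpartitions j {1..m})"
  by (simp add: card_kpartitions)

end

theory Submission
  imports Defs
begin

text \<open>Replace the family by a \<open>t\<close>-intersecting family of sets of blocks that covers it and in
  which no member can be shrunk. Then a proper subset \<open>X\<close> of a member with at least \<open>t\<close>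
  blocks meets some \<open>C\<close> in fewer than \<open>t\<close> blocks, so \<open>X\<close> extends to a member of the
  largest size \<open>t + i\<close> through one of only \<open>i + 1\<close> blocks of \<open>C\<close>. Hence at most
  \<open>(t + i choose t) (i + 1)^i \<le> (e k)^i\<close> members have size \<open>t + i\<close>. Splitting blocks shows
  \<open>S(m, j) \<ge> 2 e k S(m - 1, j - 1)\<close>, so they cover at most \<open>2^-i S(n - t, k - t)\<close>
  partitions. Peeling off the largest members, shrinking again and iterating bounds a
  family without \<open>t\<close> common blocks by a geometric series. At the top size \<open>k\<close> the last block
  is determined by the others, which costs a factor \<open>2 e k\<close>; it is regained by counting full
  partitions more carefully.\<close>

section \<open>Stirling numbers and partitions with prescribed blocks\<close>

lemma kpartitionsD:
  assumes "P \<in> kpartitions k A"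
  shows "partition_on A P" "card P = k" "\<Union>P = A" "{} \<notin> P" "disjoint P"
  using assms by (auto simp: kpartitions_def partition_on_def)

lemma block_eq:
  assumes "P \<in> kpartitions k A" "B \<in> P" "C \<in> P" "p \<in> B" "p \<in> C"
  shows "B = C"
  using assms kpartitionsD(5)[OF assms(1)] by (auto simp: disjoint_def)

lemma sum_card_blocks:
  assumes "finite A" "P \<in> kpartitions k A"
  shows "(\<Sum>B\<in>P. card B) = card A"
proof -
  have "finite B" if "B \<in> P" for B
    using that assms(1) kpartitionsD(3)[OF assms(2)] by (metis Union_upper finite_subset)
  then show ?thesis
    using product_partition[OF kpartitionsD(1)[OF assms(2)]] by simp
qed

section \<open>Splitting one block in two\<close>

lemma kpartitions_split_block:
  assumes A: "finite A" and Q: "Q \<in> kpartitions k A" and B: "B \<in> Q" and Y: "Y \<subset> B" "Y \<noteq> {}"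
  shows "insert Y (insert (B - Y) (Q - {B})) \<in> kpartitions (Suc k) A"
    and "Y \<notin> Q - {B}" "B - Y \<notin> Q - {B}"
proof -
  note Q' = kpartitionsD[OF Q]
  have disj: "C \<inter> B = {}" if "C \<in> Q - {B}" for C
    using Q'(5) B that by (auto simp: disjoint_def)
  show YQ: "Y \<notin> Q - {B}" using disj[of Y] Y by blast
  show BYQ: "B - Y \<notin> Q - {B}" using disj[of "B - Y"] Y by blast
  have ne: "Y \<noteq> B - Y" using Y by blast
  have finQ: "finite Q" using finite_kpartition[OF A Q] .
  have "card (insert Y (insert (B - Y) (Q - {B}))) = Suc (Suc (card (Q - {B})))"
    using YQ BYQ ne finQ by simp
  moreover have "card Q = Suc (card (Q - {B}))"
    using finQ B by (metis card.remove)
  moreover have "partition_on A (insert Y (insert (B - Y) (Q - {B})))"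
    unfolding partition_on_def
  proof (intro conjI)
    show "\<Union>(insert Y (insert (B - Y) (Q - {B}))) = A" using Q'(3) B Y by auto
    show "{} \<notin> insert Y (insert (B - Y) (Q - {B}))" using Q'(4) Y by auto
    have "disjoint (Q - {B})" using Q'(5) by (auto simp: disjoint_def)
    then show "disjoint (insert Y (insert (B - Y) (Q - {B})))"
      using disj Y by (simp add: pairwise_insert disjnt_def) blast
  qed
  ultimately show "insert Y (insert (B - Y) (Q - {B})) \<in> kpartitions (Suc k) A"
    using Q'(2) by (simp add: kpartitions_def)
qed

lemma card_nonempty_psubsets:
  assumes "finite B" "B \<noteq> {}"
  shows "card {Y. Y \<subset> B \<and> Y \<noteq> {}} = 2 ^ card B - 2"
proof -
  have "{Y. Y \<subset> B \<and> Y \<noteq> {}} = Pow B - {B, {}}" by auto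
  moreover have "card (Pow B - {B, {}}) = card (Pow B) - card {B, {}}"
    by (intro card_Diff_subset) auto
  ultimately show ?thesis using assms by (simp add: card_Pow)
qed

text \<open>Double counting. Splitting a block \<open>B\<close> of a \<open>k\<close>-partition into
  an ordered pair \<open>(Y, B - Y)\<close> yields a partition with \<open>Suc k\<close> blocks and
  an ordered pair of its blocks. The pair determines \<open>B\<close> as its union, and removing it
  leaves \<open>Q - {B}\<close>, so the map is injective.\<close>

lemma sum_block_splits_le:
  assumes A: "finite A"
  shows "(\<Sum>Q\<in>kpartitions k A. \<Sum>B\<in>Q. 2 ^ card B - 2) \<le> Suc k * k * Stirling (card A) (Suc k)"
proof -
  let ?D = "SIGMA Q:kpartitions k A. SIGMA B:Q. {Y. Y \<subset> B \<and> Y \<noteq> {}}"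
  let ?E = "SIGMA P:kpartitions (Suc k) A. SIGMA Y:P. P - {Y}"
  let ?f = "\<lambda>(Q, B, Y). (insert Y (insert (B - Y) (Q - {B})), Y, B - Y)"
  have finQ: "finite Q" if "Q \<in> kpartitions j A" for Q j
    using finite_kpartition[OF A that] .
  have finB: "finite B" if "Q \<in> kpartitions j A" "B \<in> Q" for Q B j
    using that(2) A kpartitionsD(3)[OF that(1)] by (metis Union_upper finite_subset)
  have neB: "B \<noteq> {}" if "Q \<in> kpartitions j A" "B \<in> Q" for Q B j
    using that(2) kpartitionsD(4)[OF that(1)] by blast
  have finS: "finite {Y. Y \<subset> B \<and> Y \<noteq> {}}" if "Q \<in> kpartitions j A" "B \<in> Q" for Q B j
    using finite_subset[of "{Y. Y \<subset> B \<and> Y \<noteq> {}}" "Pow B"] finB[OF that] by blast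
  have inj: "inj_on ?f ?D"
  proof (rule inj_onI)
    fix z z' assume D: "z \<in> ?D" "z' \<in> ?D" and zz: "?f z = ?f z'"
    obtain Q B Y where z1: "z = (Q, B, Y)"
      and *: "Q \<in> kpartitions k A" "B \<in> Q" "Y \<subset> B" "Y \<noteq> {}" using D(1) by auto
    obtain Q' B' Y' where z2: "z' = (Q', B', Y')"
      and **: "Q' \<in> kpartitions k A" "B' \<in> Q'" "Y' \<subset> B'" "Y' \<noteq> {}" using D(2) by auto
    note z = z1 z2
    have eq: "insert Y (insert (B - Y) (Q - {B})) = insert Y' (insert (B' - Y') (Q' - {B'}))"
      "Y = Y'" "B - Y = B' - Y'"
      using zz unfolding z prod.case prod.inject by blast+
    have B: "B = B'" using *(3) **(3) eq(2,3) by blast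
    have "Q - {B} = insert Y (insert (B - Y) (Q - {B})) - {Y, B - Y}"
      using kpartitions_split_block(2,3)[OF A *] by blast
    also have "\<dots> = insert Y' (insert (B' - Y') (Q' - {B'})) - {Y', B' - Y'}"
      using eq by simp
    also have "\<dots> = Q' - {B'}"
      using kpartitions_split_block(2,3)[OF A **] by blast
    finally have "Q = Q'" using B *(2) **(2) by blast
    with B eq(2) show "z = z'" by (simp add: z)
  qed
  have img: "?f ` ?D \<subseteq> ?E"
  proof (rule image_subsetI)
    fix z assume "z \<in> ?D"
    then obtain Q B Y where z: "z = (Q, B, Y)"
      and *: "Q \<in> kpartitions k A" "B \<in> Q" "Y \<subset> B" "Y \<noteq> {}" by auto
    have "B - Y \<noteq> Y" using *(4) by blast
    then show "?f z \<in> ?E" using kpartitions_split_block(1)[OF A *] by (simp add: z)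
  qed
  have finE: "finite ?E"
    using finite_kpartitions[OF A] finQ by (intro finite_SigmaI) auto
  have "card ?D = (\<Sum>Q\<in>kpartitions k A. card (SIGMA B:Q. {Y. Y \<subset> B \<and> Y \<noteq> {}}))"
  proof (intro card_SigmaI ballI)
    show "finite (kpartitions k A)" by (rule finite_kpartitions[OF A])
    show "finite (SIGMA B:Q. {Y. Y \<subset> B \<and> Y \<noteq> {}})" if "Q \<in> kpartitions k A" for Q
      using finQ[OF that] finS[OF that] by (rule finite_SigmaI)
  qed
  also have "\<dots> = (\<Sum>Q\<in>kpartitions k A. \<Sum>B\<in>Q. 2 ^ card B - 2)"
  proof (rule sum.cong[OF refl])
    fix Q assume Q: "Q \<in> kpartitions k A"
    have "card (SIGMA B:Q. {Y. Y \<subset> B \<and> Y \<noteq> {}}) = (\<Sum>B\<in>Q. card {Y. Y \<subset> B \<and> Y \<noteq> {}})"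
      using finQ[OF Q] finS[OF Q] by (intro card_SigmaI ballI) 
    also have "\<dots> = (\<Sum>B\<in>Q. 2 ^ card B - 2)"
      using card_nonempty_psubsets[OF finB[OF Q] neB[OF Q]] by (rule sum.cong[OF refl])
    finally show "card (SIGMA B:Q. {Y. Y \<subset> B \<and> Y \<noteq> {}}) = (\<Sum>B\<in>Q. 2 ^ card B - 2)" .
  qed
  finally have cD: "card ?D = (\<Sum>Q\<in>kpartitions k A. \<Sum>B\<in>Q. 2 ^ card B - 2)" .
  have "card ?E = (\<Sum>P\<in>kpartitions (Suc k) A. card (SIGMA Y:P. P - {Y}))"
  proof (intro card_SigmaI ballI)
    show "finite (kpartitions (Suc k) A)" by (rule finite_kpartitions[OF A])
    show "finite (SIGMA Y:P. P - {Y})" if "P \<in> kpartitions (Suc k) A" for P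
      using finQ[OF that] by auto
  qed
  also have "\<dots> = (\<Sum>P\<in>kpartitions (Suc k) A. Suc k * k)"
  proof (rule sum.cong[OF refl])
    fix P assume P: "P \<in> kpartitions (Suc k) A"
    have "card (SIGMA Y:P. P - {Y}) = (\<Sum>Y\<in>P. card (P - {Y}))"
      using finQ[OF P] by (intro card_SigmaI) auto
    also have "\<dots> = (\<Sum>Y\<in>P. k)"
      using finQ[OF P] kpartitionsD(2)[OF P] by (intro sum.cong) auto
    finally show "card (SIGMA Y:P. P - {Y}) = Suc k * k"
      using kpartitionsD(2)[OF P] by simp
  qed
  finally have "card ?E = Suc k * k * Stirling (card A) (Suc k)"
    by (simp add: card_kpartitions[OF A])
  with card_inj_on_le[OF inj img finE] cD show ?thesis by simp
qed

section \<open>Growth of Stirling numbers along the diagonal\<close>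

lemma two_powr_ge_tangent: "2 powr a * (1 + (x - a) * ln 2) \<le> 2 powr x" for a x :: real
proof -
  have "2 powr x = 2 powr a * exp ((x - a) * ln 2)"
    by (simp add: powr_def algebra_simps flip: exp_add)
  moreover have "1 + (x - a) * ln 2 \<le> exp ((x - a) * ln 2)"
    by (rule exp_ge_add_one_self)
  ultimately show ?thesis by simp
qed

text \<open>The average block size is \<open>m / j \<ge> L\<close>, so by convexity of
  \<open>2 powr x\<close> each \<open>j\<close>-partition has at least
  \<open>j * (2 powr L - 2)\<close> ordered splits. Summing and comparing with
  \<open>sum_block_splits_le\<close> gives the claim after division by \<open>j\<close>.\<close>

lemma Stirling_Suc_right_ge:
  assumes "real j * L \<le> real m" "0 < j"
  shows "(2 powr L - 2) * real (Stirling m j) \<le> real (Suc j) * real (Stirling m (Suc j))"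
proof -
  let ?A = "{1..m}"
  have "real j * (2 powr L - 2) \<le> (\<Sum>B\<in>Q. 2 ^ card B - 2)" if Q: "Q \<in> kpartitions j ?A" for Q
  proof -
    have s: "(\<Sum>B\<in>Q. real (card B)) = real m"
      using sum_card_blocks[OF _ Q] by (simp flip: of_nat_sum)
    \<comment> \<open>The added term is nonnegative. With it the right side is the sum over all
      blocks of the tangent to \<open>2 powr x\<close> at \<open>L\<close>.\<close>
    have "real j * 2 powr L \<le> real j * 2 powr L + 2 powr L * ln 2 * (real m - real j * L)"
      using assms by simp
    also have "\<dots> = (\<Sum>B\<in>Q. 2 powr L * (1 + (real (card B) - L) * ln 2))"
      using kpartitionsD(2)[OF Q] s
      by (simp add: algebra_simps sum.distrib sum_subtractf flip: sum_distrib_left sum_distrib_right)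
    also have "\<dots> \<le> (\<Sum>B\<in>Q. 2 powr real (card B))"
      by (intro sum_mono two_powr_ge_tangent)
    also have "\<dots> = (\<Sum>B\<in>Q. 2 ^ card B)" by (simp add: powr_realpow)
    finally show ?thesis
      using kpartitionsD(2)[OF Q] by (simp add: sum_subtractf algebra_simps)
  qed
  then have "(\<Sum>Q\<in>kpartitions j ?A. real j * (2 powr L - 2))
      \<le> (\<Sum>Q\<in>kpartitions j ?A. \<Sum>B\<in>Q. 2 ^ card B - 2)"
    by (intro sum_mono)
  also have "\<dots> = real (\<Sum>Q\<in>kpartitions j ?A. \<Sum>B\<in>Q. 2 ^ card B - 2)"
  proof -
    \<comment> \<open>Subtraction on \<open>nat\<close> is truncated; blocks are nonempty, so
      nothing is cut off here.\<close>
    have "2 ^ card B - 2 = real (2 ^ card B - 2)" if "Q \<in> kpartitions j ?A" "B \<in> Q" for Q B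
    proof -
      have "finite B" "B \<noteq> {}"
        using that kpartitionsD(3,4)[OF that(1)] finite_subset[of B ?A] by auto
      then have "(2::nat) ^ 1 \<le> 2 ^ card B"
        by (intro power_increasing) (auto simp: Suc_le_eq card_gt_0_iff)
      then show ?thesis by (simp add: of_nat_diff)
    qed
    then show ?thesis by simp
  qed
  also have "\<dots> \<le> real (Suc j * j * Stirling m (Suc j))"
    using sum_block_splits_le[of ?A j] by (simp only: of_nat_le_iff) simp
  finally have "real j * ((2 powr L - 2) * real (Stirling m j))
      \<le> real j * (real (Suc j) * real (Stirling m (Suc j)))"
    by (simp add: card_kpartitions algebra_simps)
  with assms(2) show ?thesis by simp
qed

text \<open>For \<open>L = log 2 (c + 1)\<close> the factor \<open>2 powr L - 2\<close> is
  \<open>c - 1\<close>; the missing 1 is the term \<open>Stirling m j\<close> of the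
  recurrence.\<close>

lemma Stirling_Suc_Suc_ge:
  assumes "real j * log 2 (c + 1) \<le> real m" "0 < j" "0 < c"
  shows "c * real (Stirling m j) \<le> real (Stirling (Suc m) (Suc j))"
proof -
  have "(c + 1 - 2) * real (Stirling m j) \<le> real (Suc j) * real (Stirling m (Suc j))"
    using Stirling_Suc_right_ge[OF assms(1,2)] assms(3) by simp
  then show ?thesis by (simp add: algebra_simps)
qed

text \<open>Iterates the previous ratio. With \<open>n - t\<close>, \<open>k - t\<close> and
  \<open>c = 2 e k\<close> the first hypothesis is the bound on \<open>n\<close> in the
  theorem.\<close>

lemma Stirling_diff_ge:
  assumes "real (k - 1) * log 2 (c + 1) + 1 \<le> real n" "1 \<le> c" "i < k"
  shows "real (Stirling (n - i) (k - i)) * c ^ i \<le> real (Stirling n k)"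
  using assms(3)
proof (induction i)
  case (Suc i)
  let ?L = "log 2 (c + 1)"
  have L: "1 \<le> ?L" using assms(2) by simp
  have kn: "real (k - 1) * 1 \<le> real (k - 1) * ?L" by (intro mult_left_mono L) simp
  then have kn': "k \<le> n" using assms(1) by simp
  \<comment> \<open>Lowering both arguments takes \<open>i * ?L\<close> off the left side but only
    \<open>i\<close> off the right, so the condition on the average block size survives.\<close>
  have "real i * 1 \<le> real i * ?L" by (intro mult_left_mono L) simp
  then have "real (k - Suc i) * ?L \<le> real (n - Suc i)"
    using assms(1) Suc.prems kn' by (simp add: of_nat_diff algebra_simps)
  then have "c * real (Stirling (n - Suc i) (k - Suc i))
      \<le> real (Stirling (Suc (n - Suc i)) (Suc (k - Suc i)))"
    using Suc.prems assms(2) by (intro Stirling_Suc_Suc_ge) auto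
  also have "Suc (n - Suc i) = n - i" using Suc.prems kn' by simp
  also have "Suc (k - Suc i) = k - i" using Suc.prems by simp
  finally have "c * real (Stirling (n - Suc i) (k - Suc i)) * c ^ i
      \<le> real (Stirling (n - i) (k - i)) * c ^ i"
    using assms(2) by (intro mult_right_mono) auto
  with Suc show ?case by (simp add: mult_ac)
qed simp

lemma Stirling_mono_left:
  assumes "m \<le> m'" "0 < j"
  shows "Stirling m j \<le> Stirling m' j"
proof -
  have "Stirling m j \<le> Stirling (Suc m) j" for m
    using assms(2) by (cases j) auto
  then show ?thesis using lift_Suc_mono_le[of "\<lambda>m. Stirling m j"] assms(1) by blast
qed

lemma Stirling_pos: "0 < j \<Longrightarrow> j \<le> m \<Longrightarrow> 0 < Stirling m j"
  using Stirling_mono_left[of j m j] by simp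

text \<open>The recurrence adds \<open>Stirling m (j - 1)\<close>, which is positive for
  \<open>2 \<le> j\<close>. This strictness is behind the uniqueness of the extremal
  families.\<close>

lemma Stirling_less_Suc:
  assumes "2 \<le> j" "j \<le> Suc m"
  shows "Stirling m j < Stirling (Suc m) j"
proof -
  obtain i where i: "j = Suc i" "0 < i" using assms(1) by (cases j) auto
  have "0 < Stirling m i" using assms i by (intro Stirling_pos) auto
  then show ?thesis using i by simp
qed

section \<open>Partitions containing prescribed blocks\<close>

lemma kpartitions_Diff:
  assumes "P \<in> kpartitions k A" "X \<subseteq> P" "finite X"
  shows "P - X \<in> kpartitions (k - card X) (A - \<Union>X)"
proof -
  note P = kpartitionsD[OF assms(1)]
  have "B \<inter> C = {}" if "B \<in> P - X" "C \<in> X" for B C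
  proof -
    have "B \<in> P" "C \<in> P" "B \<noteq> C" using that assms(2) by auto
    with P(5) show ?thesis by (simp add: disjoint_def)
  qed
  then have "\<Union>(P - X) = A - \<Union>X" using P(3) assms(2) by blast
  moreover have "disjoint (P - X)" "{} \<notin> P - X"
    using P(4,5) by (auto simp: disjoint_def)
  moreover have "card (P - X) = k - card X"
    using P(2) card_Diff_subset[OF assms(3,2)] by simp
  ultimately show ?thesis by (simp add: kpartitions_def partition_on_def)
qed

text \<open>The last block is whatever the other \<open>m\<close> leave uncovered. This shortens the
  search for full partitions by one level.\<close>

lemma kpartition_eq_insert:
  assumes A: "finite A" and T: "T \<in> kpartitions (Suc m) A" and Y: "Y \<subseteq> T" "card Y = m"
  shows "T = insert (A - \<Union>Y) Y"
proof -
  have fin: "finite T" "finite Y"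
    using finite_kpartition[OF A T] Y(1) finite_subset by auto
  then have "T - Y \<in> kpartitions 1 (A - \<Union>Y)"
    using kpartitions_Diff[OF T Y(1)] Y(2) by simp
  from kpartitionsD(2,3)[OF this] have "T - Y = {A - \<Union>Y}"
    by (metis card_1_singletonE ccpo_Sup_singleton)
  with Y(1) show ?thesis by blast
qed

lemma card_superfamily_le_Union:
  assumes "finite A" "finite X"
  shows "card {P \<in> kpartitions k A. X \<subseteq> P} \<le> Stirling (card (A - \<Union>X)) (k - card X)"
proof -
  have "inj_on (\<lambda>P. P - X) {P \<in> kpartitions k A. X \<subseteq> P}" by (auto simp: inj_on_def)
  moreover have "(\<lambda>P. P - X) ` {P \<in> kpartitions k A. X \<subseteq> P}
      \<subseteq> kpartitions (k - card X) (A - \<Union>X)"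
    using kpartitions_Diff[OF _ _ assms(2)] by blast
  ultimately have "card {P \<in> kpartitions k A. X \<subseteq> P}
      \<le> card (kpartitions (k - card X) (A - \<Union>X))"
    using finite_kpartitions[of "A - \<Union>X"] assms(1) by (intro card_inj_on_le) auto
  then show ?thesis using card_kpartitions[of "A - \<Union>X"] assms(1) by simp
qed

text \<open>Blocks are disjoint and each contributes at least one point; equality allows exactly one
  point per block.\<close>

lemma card_Union_blocks_ge:
  assumes "finite A" "P \<in> kpartitions k A" "X \<subseteq> P"
  shows "card X \<le> card (\<Union>X)"
    and "card (\<Union>X) = card X \<Longrightarrow> B \<in> X \<Longrightarrow> card B = 1"
proof -
  have fin: "finite X" "\<And>B. B \<in> X \<Longrightarrow> finite B"
    using assms finite_kpartition[OF assms(1,2)] kpartitionsD(3)[OF assms(2)]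
      finite_subset[of _ A] finite_subset[of X P] by auto
  have ge1: "1 \<le> card B" if "B \<in> X" for B
  proof -
    have "B \<noteq> {}" using that assms(3) kpartitionsD(4)[OF assms(2)] by blast
    then show ?thesis using fin(2)[OF that] by (simp add: Suc_le_eq card_gt_0_iff)
  qed
  have "pairwise disjnt X"
    using kpartitionsD(5)[OF assms(2)] assms(3) pairwise_subset by blast
  then have c: "card (\<Union>X) = (\<Sum>B\<in>X. card B)"
    using fin by (intro card_Union_disjoint) auto
  show "card X \<le> card (\<Union>X)"
    using sum_mono[of X "\<lambda>_. 1" card] ge1 c by simp
  show "card B = 1" if "card (\<Union>X) = card X" "B \<in> X"
  proof (rule ccontr)
    assume "card B \<noteq> 1"
    have "(\<Sum>B\<in>X. 1) < (\<Sum>B\<in>X. card B)"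
    proof (rule sum_strict_mono_ex1[OF fin(1)])
      show "\<forall>B\<in>X. 1 \<le> card B" using ge1 by blast
      show "\<exists>B\<in>X. 1 < card B"
        using ge1[OF that(2)] \<open>card B \<noteq> 1\<close> that(2) le_neq_implies_less by metis
    qed
    with that(1) c show False by simp
  qed
qed

text \<open>Once \<open>X\<close> lies in some partition it uses up at least \<open>card X\<close>
  points, and Stirling numbers with positive second argument grow with the first.\<close>

lemma card_superfamily_le:
  assumes A: "finite A" and X: "finite X" "card X < k"
  shows "card {P \<in> kpartitions k A. X \<subseteq> P} \<le> Stirling (card A - card X) (k - card X)"
proof (cases "\<exists>P\<in>kpartitions k A. X \<subseteq> P")
  case True
  then obtain P where P: "P \<in> kpartitions k A" "X \<subseteq> P" by blast
  have "\<Union>X \<subseteq> A" using P kpartitionsD(3) by blast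
  then have "card (A - \<Union>X) = card A - card (\<Union>X)"
    using A finite_subset by (intro card_Diff_subset) auto
  then have "Stirling (card (A - \<Union>X)) (k - card X) \<le> Stirling (card A - card X) (k - card X)"
    using card_Union_blocks_ge(1)[OF A P] X(2) by (intro Stirling_mono_left) auto
  then show ?thesis using card_superfamily_le_Union[OF A X(1)] le_trans by blast
next
  case False
  then have "{P \<in> kpartitions k A. X \<subseteq> P} = {}" by blast
  then show ?thesis by (simp only: card.empty)
qed

text \<open>A block that is not a singleton uses up one point more. As
  \<open>card X + 2 \<le> k\<close>, at least two blocks remain, and losing a point lowers the
  Stirling number strictly.\<close>

lemma card_superfamily_less:
  assumes A: "finite A" and X: "finite X" "card X + 2 \<le> k" "k \<le> card A"
    and B: "B \<in> X" "card B \<noteq> 1"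
  shows "card {P \<in> kpartitions k A. X \<subseteq> P} < Stirling (card A - card X) (k - card X)"
proof (cases "\<exists>P\<in>kpartitions k A. X \<subseteq> P")
  case True
  then obtain P where P: "P \<in> kpartitions k A" "X \<subseteq> P" by blast
  have "\<Union>X \<subseteq> A" using P kpartitionsD(3) by blast
  then have c: "card (A - \<Union>X) = card A - card (\<Union>X)"
    using A finite_subset by (intro card_Diff_subset) auto
  have "card X < card (\<Union>X)"
    using card_Union_blocks_ge[OF A P] B le_neq_implies_less by metis
  then have "Stirling (card (A - \<Union>X)) (k - card X)
      \<le> Stirling (card A - Suc (card X)) (k - card X)"
    using c X(2) by (intro Stirling_mono_left) auto
  also have "\<dots> < Stirling (Suc (card A - Suc (card X))) (k - card X)"
    using X by (intro Stirling_less_Suc) auto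
  also have "Suc (card A - Suc (card X)) = card A - card X" using X by simp
  finally show ?thesis using card_superfamily_le_Union[OF A X(1), of k] by simp
next
  case False
  then have "{P \<in> kpartitions k A. X \<subseteq> P} = {}" by blast
  moreover have "0 < Stirling (card A - card X) (k - card X)"
    using X by (intro Stirling_pos) auto
  ultimately show ?thesis by (simp only: card.empty)
qed

text \<open>Adjoining the singletons of \<open>T\<close> to partitions of \<open>A - T\<close> gives
  one inequality, removing them the other.\<close>

lemma card_singleton_star:
  assumes A: "finite A" and T: "T \<subseteq> A" "card T \<le> k"
  shows "card (singleton_star k A T) = Stirling (card A - card T) (k - card T)"
proof -
  let ?X = "(\<lambda>x. {x}) ` T"
  have finT: "finite T" using A T finite_subset by blast
  have cX: "card ?X = card T" by (simp add: card_image inj_on_def)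
  have UX: "\<Union>?X = T" by auto
  have star: "singleton_star k A T = {P \<in> kpartitions k A. ?X \<subseteq> P}"
    by (auto simp: singleton_star_def)
  have "(\<union>) ?X ` kpartitions (k - card T) (A - T) \<subseteq> {P \<in> kpartitions k A. ?X \<subseteq> P}"
  proof clarify
    fix Q assume Q: "Q \<in> kpartitions (k - card T) (A - T)"
    note Q' = kpartitionsD[OF Q]
    have nQ: "x \<notin> B" if "x \<in> T" "B \<in> Q" for x B using Q'(3) that by blast
    then have "?X \<inter> Q = {}" by auto
    moreover have "finite Q" using finite_kpartition[OF _ Q] A by simp
    ultimately have "card (?X \<union> Q) = k"
      using finT cX Q'(2) T(2) by (subst card_Un_disjoint) auto
    moreover have "partition_on A (?X \<union> Q)"
      unfolding partition_on_def
    proof (intro conjI)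
      show "\<Union>(?X \<union> Q) = A" using Q'(3) T by auto
      show "{} \<notin> ?X \<union> Q" using Q'(4) by auto
      show "disjoint (?X \<union> Q)"
        using Q'(5) nQ by (auto simp: disjoint_def)
    qed
    ultimately show "?X \<union> Q \<in> kpartitions k A \<and> ?X \<subseteq> ?X \<union> Q"
      by (auto simp: kpartitions_def)
  qed
  moreover have "inj_on ((\<union>) ?X) (kpartitions (k - card T) (A - T))"
  proof (rule inj_onI)
    fix Q R assume QR: "Q \<in> kpartitions (k - card T) (A - T)" "R \<in> kpartitions (k - card T) (A - T)"
      and eq: "?X \<union> Q = ?X \<union> R"
    have "?X \<union> S - ?X = S" if "S \<in> kpartitions (k - card T) (A - T)" for S
      using kpartitionsD(3)[OF that] by auto
    with QR eq show "Q = R" by metis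
  qed
  ultimately have "card (kpartitions (k - card T) (A - T)) \<le> card (singleton_star k A T)"
    unfolding star using finite_kpartitions[OF A] by (intro card_inj_on_le) auto
  moreover have "card (singleton_star k A T) \<le> Stirling (card (A - \<Union>?X)) (k - card ?X)"
    unfolding star using A finT by (intro card_superfamily_le_Union) auto
  moreover have "card (A - T) = card A - card T"
    using finT T by (simp add: card_Diff_subset)
  ultimately show ?thesis
    unfolding UX cX using card_kpartitions[of "A - T"] A by simp
qed

section \<open>Saturated intersecting families\<close>

text \<open>Unlike \<open>t_intersecting\<close>, this includes \<open>S = T\<close>, which forces
  every member to have at least \<open>t\<close> elements.\<close>

definition t_int :: "nat \<Rightarrow> 'a set set \<Rightarrow> bool" where
  "t_int t \<T> \<longleftrightarrow> (\<forall>S\<in>\<T>. \<forall>T\<in>\<T>. t \<le> card (S \<inter> T))"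

text \<open>No member can be replaced by a proper subset without destroying \<open>t_int\<close>;
  the bound \<open>t \<le> card X\<close> is the condition of \<open>X\<close> against
  itself.\<close>

definition saturated :: "nat \<Rightarrow> 'a set set \<Rightarrow> bool" where
  "saturated t \<T> \<longleftrightarrow>
    (\<forall>T\<in>\<T>. \<forall>X. X \<subset> T \<and> t \<le> card X \<longrightarrow> (\<exists>C\<in>\<T>. card (X \<inter> C) < t))"

lemma t_intD: "t_int t \<T> \<Longrightarrow> S \<in> \<T> \<Longrightarrow> T \<in> \<T> \<Longrightarrow> t \<le> card (S \<inter> T)"
  by (simp add: t_int_def)

lemma t_int_card: "t_int t \<T> \<Longrightarrow> T \<in> \<T> \<Longrightarrow> t \<le> card T"
  using t_intD[of t \<T> T T] by simp

lemma t_int_subset: "t_int t \<T> \<Longrightarrow> \<R> \<subseteq> \<T> \<Longrightarrow> t_int t \<R>"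
  by (auto simp: t_int_def)

lemma saturatedE:
  assumes "saturated t \<T>" "T \<in> \<T>" "X \<subset> T" "t \<le> card X"
  obtains C where "C \<in> \<T>" "card (X \<inter> C) < t"
  using assms unfolding saturated_def by blast

text \<open>Keep replacing a member by a smaller set while \<open>t_int\<close> permits; the total
  size decreases. Of the last two conclusions, the first keeps every partition covered and the
  second preserves bounds on the sizes of members.\<close>

lemma saturated_refinement:
  assumes "finite \<T>" "\<And>T. T \<in> \<T> \<Longrightarrow> finite T" "t_int t \<T>"
  obtains \<S> where "finite \<S>" "t_int t \<S>" "saturated t \<S>"
    "\<And>T. T \<in> \<T> \<Longrightarrow> \<exists>S\<in>\<S>. S \<subseteq> T" "\<And>S. S \<in> \<S> \<Longrightarrow> \<exists>T\<in>\<T>. S \<subseteq> T"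
proof -
  have "\<exists>\<S>. finite \<S> \<and> t_int t \<S> \<and> saturated t \<S> \<and>
    (\<forall>T\<in>\<T>. \<exists>S\<in>\<S>. S \<subseteq> T) \<and> (\<forall>S\<in>\<S>. \<exists>T\<in>\<T>. S \<subseteq> T)"
    using assms
  proof (induction "sum card \<T>" arbitrary: \<T> rule: less_induct)
    case less
    show ?case
    proof (cases "saturated t \<T>")
      case True
      with less.prems show ?thesis by blast
    next
      case False
      then obtain T X where T: "T \<in> \<T>" "X \<subset> T" "t \<le> card X"
        and X: "\<And>C. C \<in> \<T> \<Longrightarrow> t \<le> card (X \<inter> C)"
        unfolding saturated_def by (meson not_less)
      define \<U> where "\<U> = insert X (\<T> - {T})"
      have finU: "finite \<U>" using less.prems by (simp add: \<U>_def)
      \<comment> \<open>Only an inequality, since \<open>X\<close> may already be a member.\<close>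
      have "sum card \<U> \<le> card X + sum card (\<T> - {T})"
        using less.prems by (simp add: \<U>_def sum.insert_if)
      also have "\<dots> < card T + sum card (\<T> - {T})"
        using T less.prems by (simp add: psubset_card_mono)
      also have "\<dots> = sum card \<T>"
        using T less.prems by (simp add: sum.remove)
      finally have lt: "sum card \<U> < sum card \<T>" .
      have "t_int t \<U>"
        using less.prems(3) T(3) X by (auto simp: t_int_def \<U>_def Int_commute)
      moreover have "finite S" if "S \<in> \<U>" for S
        using that T less.prems(2) finite_subset[of X T] by (auto simp: \<U>_def)
      ultimately obtain \<S> where \<S>: "finite \<S>" "t_int t \<S>" "saturated t \<S>"
        "\<forall>T\<in>\<U>. \<exists>S\<in>\<S>. S \<subseteq> T" "\<forall>S\<in>\<S>. \<exists>T\<in>\<U>. S \<subseteq> T"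
        using less.hyps[OF lt finU] by blast
      have "\<exists>S\<in>\<S>. S \<subseteq> T'" if T': "T' \<in> \<T>" for T'
      proof -
        have "\<exists>U\<in>\<U>. U \<subseteq> T'" using T' T(2) unfolding \<U>_def by blast
        with \<S>(4) show ?thesis by (meson subset_trans)
      qed
      moreover have "\<exists>T'\<in>\<T>. S \<subseteq> T'" if S: "S \<in> \<S>" for S
      proof -
        have "\<exists>U\<in>\<T>. T' \<subseteq> U" if "T' \<in> \<U>" for T'
          using that T(1,2) unfolding \<U>_def by blast
        with \<S>(5) S show ?thesis by (meson subset_trans)
      qed
      ultimately show ?thesis using \<S> by blast
    qed
  qed
  then show thesis using that by metis
qed

section \<open>Branching bound for the largest members\<close>

text \<open>Pigeonhole: a set \<open>T\<close> that avoids \<open>c\<close> elements of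
  \<open>D\<close> keeps at most \<open>card D - c\<close> of them besides
  \<open>X \<inter> C\<close>, which is too few to share \<open>t\<close> elements with
  \<open>C\<close>. If \<open>D\<close> is smaller, \<open>W\<close> is all of
  \<open>D\<close>.\<close>

lemma hitting_subset:
  assumes "finite C" "finite D" "card (X \<inter> C) < t" "card D + card (X \<inter> C) < c + t"
  obtains W where "W \<subseteq> D" "card W \<le> c"
    "\<And>T. t \<le> card (T \<inter> C) \<Longrightarrow> T \<inter> C \<subseteq> X \<union> D \<Longrightarrow> T \<inter> W \<noteq> {}"
proof -
  obtain W where W: "W \<subseteq> D" "card W = min c (card D)"
    using obtain_subset_with_card_n[of "min c (card D)" D] by auto
  have "T \<inter> W \<noteq> {}" if T: "t \<le> card (T \<inter> C)" "T \<inter> C \<subseteq> X \<union> D" for T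
  proof
    assume "T \<inter> W = {}"
    with T have "T \<inter> C \<subseteq> (X \<inter> C) \<union> (D - W)" by blast
    then have "card (T \<inter> C) \<le> card ((X \<inter> C) \<union> (D - W))"
      by (intro card_mono) (use assms in auto)
    also have "\<dots> \<le> card (X \<inter> C) + card (D - W)" by (rule card_Un_le)
    also have "card (D - W) = card D - card W"
      using W(1) assms(2) finite_subset by (intro card_Diff_subset) auto
    finally show False using T(1) assms(3,4) W(2) by (auto simp: min_def split: if_splits)
  qed
  with W show thesis by (intro that[of W]) auto
qed

text \<open>A search tree: every member above \<open>X\<close> contains one of at most
  \<open>c\<close> further elements, so each level costs a factor \<open>c\<close>. The depth is set
  by \<open>m\<close>, the size at which a subset determines the member: the full size in general,
  one less for full partitions.\<close>

lemma card_branching_le: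
  assumes G: "finite G"
    and step: "\<And>X. finite X \<Longrightarrow> t \<le> card X \<Longrightarrow> card X < m \<Longrightarrow> \<exists>T\<in>G. X \<subseteq> T \<Longrightarrow>
      \<exists>W. finite W \<and> card W \<le> c \<and> W \<inter> X = {} \<and> (\<forall>T\<in>G. X \<subseteq> T \<longrightarrow> T \<inter> W \<noteq> {})"
    and last: "\<And>Y. finite Y \<Longrightarrow> card Y = m \<Longrightarrow> card {T \<in> G. Y \<subseteq> T} \<le> 1"
    and X: "finite X" "t \<le> card X" "card X \<le> m"
  shows "card {T \<in> G. X \<subseteq> T} \<le> c ^ (m - card X)"
  using X
proof (induction "m - card X" arbitrary: X)
  case 0
  then show ?case using last[of X] by simp
next
  case (Suc d)
  show ?case
  proof (cases "\<exists>T\<in>G. X \<subseteq> T")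
    case True
    with step[of X] Suc obtain W where W: "finite W" "card W \<le> c" "W \<inter> X = {}"
      "\<And>T. T \<in> G \<Longrightarrow> X \<subseteq> T \<Longrightarrow> T \<inter> W \<noteq> {}" by (metis zero_less_Suc zero_less_diff)
    have "{T \<in> G. X \<subseteq> T} \<subseteq> (\<Union>w\<in>W. {T \<in> G. insert w X \<subseteq> T})"
    proof
      fix T assume T: "T \<in> {T \<in> G. X \<subseteq> T}"
      then obtain w where "w \<in> T" "w \<in> W" using W(4) by fastforce
      with T show "T \<in> (\<Union>w\<in>W. {T \<in> G. insert w X \<subseteq> T})" by blast
    qed
    then have "card {T \<in> G. X \<subseteq> T} \<le> card (\<Union>w\<in>W. {T \<in> G. insert w X \<subseteq> T})"
      by (intro card_mono) (use W G in auto)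
    also have "\<dots> \<le> (\<Sum>w\<in>W. card {T \<in> G. insert w X \<subseteq> T})"
      by (rule card_UN_le[OF W(1)])
    also have "\<dots> \<le> (\<Sum>w\<in>W. c ^ d)"
    proof (rule sum_mono)
      fix w assume "w \<in> W"
      then have cw: "card (insert w X) = Suc (card X)"
        using W(3) Suc.prems(1) by (subst card_insert_disjoint) auto
      show "card {T \<in> G. insert w X \<subseteq> T} \<le> c ^ d"
      proof -
        have d: "d = m - card (insert w X)"
          using cw Suc.hyps(2) by simp
        have "t \<le> card (insert w X)" "card (insert w X) \<le> m"
          using cw Suc.hyps(2) Suc.prems(2) by simp_all
        with Suc.hyps(1)[OF d] Suc.prems(1) d show ?thesis by simp
      qed
    qed
    also have "\<dots> \<le> c * c ^ d" using W(2) by simp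
    finally show ?thesis using Suc.hyps(2) by (metis power_Suc)
  next
    case False
    then have "{T \<in> G. X \<subseteq> T} = {}" by blast
    then show ?thesis by (simp only: card.empty)
  qed
qed

lemma card_covered_le:
  assumes "finite G" "finite \<A>" "\<And>T. T \<in> G \<Longrightarrow> \<exists>A\<in>\<A>. A \<subseteq> T"
    and "\<And>A. A \<in> \<A> \<Longrightarrow> card {T \<in> G. A \<subseteq> T} \<le> b"
  shows "card G \<le> card \<A> * b"
proof -
  have "card G \<le> card (\<Union>A\<in>\<A>. {T \<in> G. A \<subseteq> T})"
    using assms by (intro card_mono) auto
  also have "\<dots> \<le> (\<Sum>A\<in>\<A>. card {T \<in> G. A \<subseteq> T})" by (rule card_UN_le[OF assms(2)])
  also have "\<dots> \<le> (\<Sum>A\<in>\<A>. b)" by (rule sum_mono[OF assms(4)])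
  finally show ?thesis by simp
qed

lemma card_t_subset_cover_le:
  assumes "finite G" "finite C" "\<And>T. T \<in> G \<Longrightarrow> t \<le> card (T \<inter> C)"
    and "\<And>A. finite A \<Longrightarrow> card A = t \<Longrightarrow> card {T \<in> G. A \<subseteq> T} \<le> b"
    and "card C \<le> m"
  shows "card G \<le> (m choose t) * b"
proof -
  have "card G \<le> card {A. A \<subseteq> C \<and> card A = t} * b"
  proof (rule card_covered_le[OF assms(1)])
    show "\<exists>A\<in>{A. A \<subseteq> C \<and> card A = t}. A \<subseteq> T" if T: "T \<in> G" for T
    proof -
      obtain A where "A \<subseteq> T \<inter> C" "card A = t"
        using obtain_subset_with_card_n[OF assms(3)[OF T]] by metis
      then show ?thesis by blast
    qed
    show "card {T \<in> G. A \<subseteq> T} \<le> b" if "A \<in> {A. A \<subseteq> C \<and> card A = t}" for A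
      using that assms(2,4) finite_subset by blast
  qed (use assms in auto)
  also have "\<dots> = (card C choose t) * b" using n_subsets[OF assms(2)] by simp
  also have "\<dots> \<le> (m choose t) * b" using assms(5) by (simp add: binomial_right_mono)
  finally show ?thesis .
qed

text \<open>The searches start from the \<open>t\<close>-subsets of a fixed member \<open>C\<close>,
  one of which lies in each member. Saturation supplies, at every inner node \<open>X\<close>, a
  member \<open>D\<close> that forces a further element.\<close>

lemma card_top_level_le:
  assumes fin: "finite \<T>" "\<And>T. T \<in> \<T> \<Longrightarrow> finite T" and "t_int t \<T>" "saturated t \<T>"
    and le: "\<And>T. T \<in> \<T> \<Longrightarrow> card T \<le> t + i"
  shows "card {T \<in> \<T>. card T = t + i} \<le> (t + i choose t) * (i + 1) ^ i"
proof (cases "\<T> = {}")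
  case False
  let ?G = "{T \<in> \<T>. card T = t + i}"
  obtain C where C: "C \<in> \<T>" using False by blast
  show ?thesis
  proof (rule card_t_subset_cover_le)
    show "t \<le> card (T \<inter> C)" if "T \<in> ?G" for T
      using that C t_intD[OF assms(3)] by blast
    fix A :: "'a set" assume A: "finite A" "card A = t"
    have "card {T \<in> ?G. A \<subseteq> T} \<le> (i + 1) ^ (t + i - card A)"
    proof (rule card_branching_le)
      fix X assume X: "finite X" "t \<le> card X" "card X < t + i" "\<exists>T\<in>?G. X \<subseteq> T"
      then obtain T where T: "T \<in> \<T>" "X \<subset> T" by fastforce
      obtain D where D: "D \<in> \<T>" "card (X \<inter> D) < t"
        using saturatedE[OF assms(4) T X(2)] .
      \<comment> \<open>Since \<open>card D \<le> t + i\<close>, any \<open>i + 1\<close> elements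
        of \<open>D - X\<close> leave fewer than \<open>t\<close> elements of \<open>D\<close> to a
        member that avoids them.\<close>
      have "card (D - X) + card (X \<inter> D) = card D"
        using card_Int_Diff[OF fin(2)[OF D(1)], of X] by (simp add: Int_commute)
      then have "card (D - X) + card (X \<inter> D) < (i + 1) + t"
        using le[OF D(1)] by simp
      then obtain W where W: "W \<subseteq> D - X" "card W \<le> i + 1"
        "\<And>T. t \<le> card (T \<inter> D) \<Longrightarrow> T \<inter> D \<subseteq> X \<union> (D - X) \<Longrightarrow> T \<inter> W \<noteq> {}"
        using hitting_subset[of D "D - X" X t "i + 1"] D(2) fin(2)[OF D(1)] by auto
      have "T \<inter> W \<noteq> {}" if "T \<in> ?G" for T
        using W(3)[of T] that t_intD[OF assms(3) _ D(1)] by blast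
      moreover have "finite W" using W(1) fin(2)[OF D(1)] finite_subset by blast
      ultimately show "\<exists>W. finite W \<and> card W \<le> i + 1 \<and> W \<inter> X = {} \<and>
          (\<forall>T\<in>?G. X \<subseteq> T \<longrightarrow> T \<inter> W \<noteq> {})"
        using W(1,2) by blast
    next
      fix Y :: "'a set" assume Y: "finite Y" "card Y = t + i"
      have "T = Y" if "T \<in> ?G" "Y \<subseteq> T" for T
        using that Y(2) fin(2)[of T] card_subset_eq[of T Y] by simp
      then have "{T \<in> ?G. Y \<subseteq> T} \<subseteq> {Y}" by blast
      from card_mono[OF _ this] show "card {T \<in> ?G. Y \<subseteq> T} \<le> 1" by simp
    qed (simp_all add: A fin(1))
    then show "card {T \<in> ?G. A \<subseteq> T} \<le> (i + 1) ^ i" using A by simp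
  qed (simp_all add: fin(1) fin(2)[OF C] le[OF C])
qed simp

section \<open>Families without common blocks\<close>

text \<open>Induction with \<open>(1 + 1 / n) ^ n \<le> exp 1\<close> for \<open>n = i + 1\<close>.
  The factorial is the one that cancels against the binomial coefficient in
  \<open>choose_mult_Suc_power_le\<close>.\<close>

lemma Suc_power_le_exp_fact: "real (i + 1) ^ i \<le> exp 1 ^ i * fact i"
proof (induction i)
  case (Suc i)
  have "(1 + 1 / real (i + 1)) ^ (i + 1) \<le> exp 1"
    using exp_ge_one_plus_x_over_n_power_n[of "i + 1" 1] by simp
  then have "(1 + 1 / real (i + 1)) ^ (i + 1) * real (i + 1) ^ (i + 1)
      \<le> exp 1 * real (i + 1) ^ (i + 1)"
    by (intro mult_right_mono) auto
  moreover have "(1 + 1 / real (i + 1)) * real (i + 1) = real (Suc i + 1)"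
    by (simp add: field_simps)
  ultimately have "real (Suc i + 1) ^ (i + 1) \<le> exp 1 * real (i + 1) ^ (i + 1)"
    by (simp only: flip: power_mult_distrib)
  then have "real (Suc i + 1) ^ Suc i \<le> exp 1 * real (i + 1) * real (i + 1) ^ i"
    by (simp only: Suc_eq_plus1[symmetric] power_Suc mult.assoc)
  also have "\<dots> \<le> exp 1 * real (i + 1) * (exp 1 ^ i * fact i)"
    by (intro mult_left_mono Suc.IH) auto
  finally show ?case by (simp add: mult_ac)
qed simp

lemma choose_mult_Suc_power_le:
  "real (m choose i) * real (i + 1) ^ i \<le> (exp 1 * real m) ^ i"
proof -
  have "real (m choose i) * real (i + 1) ^ i \<le> real (m choose i) * (exp 1 ^ i * fact i)"
    by (intro mult_left_mono Suc_power_le_exp_fact) auto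
  also have "\<dots> = exp 1 ^ i * real ((m choose i) * fact i)" by simp
  also have "\<dots> \<le> exp 1 ^ i * real (m ^ i)"
    by (intro mult_left_mono) (use binomial_fact_pow[of m i] of_nat_le_iff in blast, simp)
  finally show ?thesis by (simp add: power_mult_distrib)
qed

definition covered :: "nat \<Rightarrow> 'a set \<Rightarrow> 'a set set set \<Rightarrow> 'a set set set" where
  "covered k A \<T> = {P \<in> kpartitions k A. \<exists>T\<in>\<T>. T \<subseteq> P}"

definition nontrivial :: "nat \<Rightarrow> 'a set set \<Rightarrow> bool" where
  "nontrivial t \<T> \<longleftrightarrow> (\<forall>X. finite X \<and> card X = t \<longrightarrow> (\<exists>T\<in>\<T>. \<not> X \<subseteq> T))"

lemma finite_covered: "finite A \<Longrightarrow> finite (covered k A \<T>)"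
  unfolding covered_def using finite_kpartitions[of A k] by simp

text \<open>Shrinking members can only lose common elements.\<close>

lemma nontrivial_refine:
  assumes "nontrivial t \<T>" "\<And>T. T \<in> \<T> \<Longrightarrow> \<exists>S\<in>\<S>. S \<subseteq> T"
  shows "nontrivial t \<S>"
  unfolding nontrivial_def
proof (intro allI impI, rule ccontr)
  fix X assume X: "finite X \<and> card X = t" "\<not> (\<exists>S\<in>\<S>. \<not> X \<subseteq> S)"
  then obtain T where T: "T \<in> \<T>" "\<not> X \<subseteq> T" using assms(1) unfolding nontrivial_def by blast
  obtain S where "S \<in> \<S>" "S \<subseteq> T" using assms(2)[OF T(1)] by blast
  with X(2) T(2) show False by blast
qed

section \<open>Members that are full partitions\<close>

lemma kpartition_subset_eq:
  assumes "finite A" "P \<in> kpartitions k A" "T \<subseteq> P" "card T = k"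
  shows "T = P"
  using card_subset_eq[OF finite_kpartition[OF assms(1,2)] assms(3)] assms(4) kpartitionsD(2)[OF assms(2)]
  by simp

text \<open>Compared with \<open>card_top_level_le\<close> at size \<open>Suc m\<close>, both depth
  and width drop by one: \<open>m\<close> blocks determine a full partition, and every branching
  loses one candidate.\<close>

lemma card_kpartitions_superfamily_le:
  assumes A: "finite A" and \<T>: "finite \<T>" "t_int t \<T>" "saturated t \<T>"
    and sub: "\<And>T. T \<in> \<T> \<Longrightarrow> \<exists>P\<in>kpartitions (Suc m) A. T \<subseteq> P"
    and X: "finite X" "card X = t" "t \<le> m"
  shows "card {T \<in> \<T> \<inter> kpartitions (Suc m) A. X \<subseteq> T} \<le> (Suc m - t) ^ (m - t)"
proof -
  let ?G = "\<T> \<inter> kpartitions (Suc m) A"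
  have fin: "finite T" "card T \<le> Suc m" if T: "T \<in> \<T>" for T
  proof -
    obtain P where P: "P \<in> kpartitions (Suc m) A" "T \<subseteq> P" using sub[OF T] by blast
    have "finite P" by (rule finite_kpartition[OF A P(1)])
    then show "finite T" "card T \<le> Suc m"
      using finite_subset[OF P(2)] card_mono[OF _ P(2)] kpartitionsD(2)[OF P(1)] by auto
  qed
  have "card {T \<in> ?G. X \<subseteq> T} \<le> (Suc m - t) ^ (m - card X)"
  proof (rule card_branching_le)
    fix Y assume Y: "finite Y" "t \<le> card Y" "card Y < m" "\<exists>T\<in>?G. Y \<subseteq> T"
    then obtain T where T: "T \<in> \<T>" "T \<in> kpartitions (Suc m) A" "Y \<subseteq> T" by blast
    have "Y \<noteq> T" using Y(3) kpartitionsD(2)[OF T(2)] by auto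
    with T(3) have "Y \<subset> T" by blast
    then obtain C where C: "C \<in> \<T>" "card (Y \<inter> C) < t"
      using saturatedE[OF \<T>(3) T(1) _ Y(2)] by metis
    have finC: "finite C" "card C \<le> Suc m" using fin[OF C(1)] by auto
    \<comment> \<open>One candidate has to be saved against the size bound \<open>Suc m\<close>. A
      smaller \<open>C\<close> saves it by itself; in a full partition \<open>C\<close> some block
      is incompatible with \<open>Y\<close>.\<close>
    obtain D where D: "D \<subseteq> C - Y" "card D + card (Y \<inter> C) < Suc m"
      "\<And>T. T \<in> ?G \<Longrightarrow> Y \<subseteq> T \<Longrightarrow> T \<inter> C \<subseteq> Y \<union> D"
    proof (cases "card C = Suc m")
      case False
      have "card (C - Y) + card (Y \<inter> C) = card C"
        using card_Int_Diff[OF finC(1), of Y] by (simp add: Int_commute)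
      with False finC(2) show thesis by (intro that[of "C - Y"]) auto
    next
      case True
      obtain P where P: "P \<in> kpartitions (Suc m) A" "C \<subseteq> P" using sub[OF C(1)] by blast
      have Ck: "C \<in> kpartitions (Suc m) A" using kpartition_subset_eq[OF A P True] P(1) by simp
      \<comment> \<open>Outside \<open>Y\<close>, a partition containing \<open>Y\<close> can only
        use blocks of \<open>C\<close> that are disjoint from those of \<open>Y\<close>.\<close>
      define D where "D = {B \<in> C - Y. B \<inter> \<Union>Y = {}}"
      \<comment> \<open>Some block \<open>y\<close> of \<open>Y\<close> is not in \<open>C\<close>.
        The block \<open>B\<close> of \<open>C\<close> through a point of \<open>y\<close> is the
        saved candidate: it lies neither in \<open>Y\<close> nor in \<open>D\<close>.\<close>
      have "card (Y \<inter> C) < card Y" using C(2) Y(2) by simp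
      then have "\<not> Y \<subseteq> C" by (metis Int_absorb2 less_irrefl)
      then obtain y where y: "y \<in> Y" "y \<notin> C" by blast
      have "y \<in> T" using y T(3) by blast
      then have "y \<noteq> {}" using kpartitionsD(4)[OF T(2)] by metis
      then obtain p where p: "p \<in> y" by blast
      have "p \<in> \<Union>C" using p \<open>y \<in> T\<close> kpartitionsD(3)[OF T(2)] kpartitionsD(3)[OF Ck] by blast
      then obtain B where B: "B \<in> C" "p \<in> B" by blast
      have "B \<notin> Y"
      proof
        assume "B \<in> Y"
        then have "B = y" using block_eq[OF T(2) _ \<open>y \<in> T\<close> B(2) p] T(3) by blast
        with y(2) B(1) show False by simp
      qed
      moreover have "B \<notin> D" using B(2) p y(1) by (auto simp: D_def)
      ultimately have "D \<union> (Y \<inter> C) \<subset> C" using B(1) by (auto simp: D_def)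
      then have "card (D \<union> (Y \<inter> C)) < card C" by (rule psubset_card_mono[OF finC(1)])
      moreover have "finite D" using finC(1) by (simp add: D_def)
      then have "card (D \<union> (Y \<inter> C)) = card D + card (Y \<inter> C)"
        using finC(1) by (intro card_Un_disjoint) (auto simp: D_def)
      ultimately have "card D + card (Y \<inter> C) < Suc m" using True by simp
      moreover have "S \<inter> C \<subseteq> Y \<union> D" if S: "S \<in> ?G" "Y \<subseteq> S" for S
      proof
        fix B assume B: "B \<in> S \<inter> C"
        have "B \<in> D" if "B \<notin> Y"
        proof -
          have "B \<inter> E = {}" if E: "E \<in> Y" for E
          proof (rule ccontr)
            assume "B \<inter> E \<noteq> {}"
            then obtain q where "q \<in> B" "q \<in> E" by blast
            then have "B = E" using block_eq[of S "Suc m" A B E q] S B E by blast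
            with \<open>B \<notin> Y\<close> E show False by simp
          qed
          then show ?thesis using B \<open>B \<notin> Y\<close> by (auto simp: D_def)
        qed
        then show "B \<in> Y \<union> D" by blast
      qed
      moreover have "D \<subseteq> C - Y" by (auto simp: D_def)
      ultimately show thesis using that by blast
    qed
    have finD: "finite D" using D(1) finC(1) finite_subset by blast
    have "card D + card (Y \<inter> C) < (Suc m - t) + t" using D(2) X(3) by simp
    then obtain W where W: "W \<subseteq> D" "card W \<le> Suc m - t"
      "\<And>T. t \<le> card (T \<inter> C) \<Longrightarrow> T \<inter> C \<subseteq> Y \<union> D \<Longrightarrow> T \<inter> W \<noteq> {}"
      using hitting_subset[OF finC(1) finD C(2)] by metis
    have "S \<inter> W \<noteq> {}" if "S \<in> ?G" "Y \<subseteq> S" for S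
      using W(3) t_intD[OF \<T>(2) _ C(1)] D(3) that by blast
    moreover have "finite W" using W(1) finD finite_subset by blast
    moreover have "W \<inter> Y = {}" using W(1) D(1) by blast
    ultimately show "\<exists>W. finite W \<and> card W \<le> Suc m - t \<and> W \<inter> Y = {} \<and>
        (\<forall>S\<in>?G. Y \<subseteq> S \<longrightarrow> S \<inter> W \<noteq> {})"
      using W(2) by blast
  next
    fix Y :: "'a set set" assume Y: "finite Y" "card Y = m"
    have "T = insert (A - \<Union>Y) Y" if "T \<in> ?G" "Y \<subseteq> T" for T
      using kpartition_eq_insert[OF A _ that(2) Y(2)] that(1) by blast
    then have "{T \<in> ?G. Y \<subseteq> T} \<subseteq> {insert (A - \<Union>Y) Y}" by blast
    from card_mono[OF _ this] show "card {T \<in> ?G. Y \<subseteq> T} \<le> 1" by simp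
  qed (use \<T>(1) X in simp_all)
  then show ?thesis using X(2) by simp
qed

text \<open>Starting the searches inside a member \<open>C\<close> that is not a full partition
  yields \<open>m choose t\<close> in place of \<open>Suc m choose t\<close>.\<close>

lemma card_kpartitions_in_saturated_le:
  assumes A: "finite A" and \<T>: "finite \<T>" "t_int t \<T>" "saturated t \<T>"
    and sub: "\<And>T. T \<in> \<T> \<Longrightarrow> \<exists>P\<in>kpartitions (Suc m) A. T \<subseteq> P"
    and t: "t \<le> m" and C: "C \<in> \<T>" "finite C" "card C \<le> m"
  shows "card (\<T> \<inter> kpartitions (Suc m) A) \<le> (m choose t) * (Suc m - t) ^ (m - t)"
proof (rule card_t_subset_cover_le)
  show "t \<le> card (T \<inter> C)" if "T \<in> \<T> \<inter> kpartitions (Suc m) A" for T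
    using that t_intD[OF \<T>(2) _ C(1)] by blast
  show "card {T \<in> \<T> \<inter> kpartitions (Suc m) A. X \<subseteq> T} \<le> (Suc m - t) ^ (m - t)"
    if "finite X" "card X = t" for X
    using card_kpartitions_superfamily_le[OF A \<T> sub that t] .
qed (use \<T>(1) C in simp_all)

text \<open>Saturation yields members \<open>P\<close> and \<open>C\<close> sharing exactly \<open>t\<close> blocks. No other
  member contains all of \<open>P - C\<close>: its common blocks with \<open>C\<close> would then all lie in \<open>P\<close>.\<close>

lemma card_saturated_kpartitions_le:
  assumes A: "finite A" and \<T>: "finite \<T>" "t_int t \<T>" "saturated t \<T>"
    and sub: "\<T> \<subseteq> kpartitions (Suc m) A" and t: "t \<le> m"
  shows "card \<T> \<le> (Suc m - t) * (m choose t) * (Suc m - t) ^ (m - t)"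
proof (cases "\<T> = {}")
  case False
  then obtain P where P: "P \<in> \<T>" by blast
  then have Pk: "P \<in> kpartitions (Suc m) A" using sub by blast
  have finP: "finite P" by (rule finite_kpartition[OF A Pk])
  have cP: "card P = Suc m" by (rule kpartitionsD(2)[OF Pk])
  then obtain B where B: "B \<in> P" by fastforce
  \<comment> \<open>Deleting one block lowers an intersection by at most one, so saturation at
    \<open>P - {B}\<close> produces a \<open>C\<close> that shares exactly \<open>t\<close> blocks
    with \<open>P\<close>.\<close>
  have "card (P - {B}) = m" using B cP finP by simp
  moreover have "P - {B} \<subset> P" using B by blast
  ultimately obtain C where C: "C \<in> \<T>" "card ((P - {B}) \<inter> C) < t"
    using saturatedE[OF \<T>(3) P] t by metis
  then have Ck: "C \<in> kpartitions (Suc m) A" using sub by blast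
  have "P \<inter> C \<subseteq> insert B ((P - {B}) \<inter> C)" by blast
  then have "card (P \<inter> C) \<le> card (insert B ((P - {B}) \<inter> C))"
    using finP by (intro card_mono) auto
  also have "\<dots> \<le> t" using C(2) finP by (simp add: card_insert_if)
  finally have PC: "card (P \<inter> C) = t" using t_intD[OF \<T>(2) P C(1)] by simp
  define D where "D = P - C"
  have cD: "card D = Suc m - t"
    using card_Int_Diff[OF finP, of C] PC cP by (simp add: D_def)
  \<comment> \<open>A \<open>t\<close>-subset of \<open>P\<close> that does not contain
    \<open>D\<close> misses some \<open>d \<in> D\<close>, which leaves \<open>m choose t\<close>
    choices for each of the \<open>Suc m - t\<close> blocks \<open>d\<close>.\<close>
  define \<A> where "\<A> = {X. X \<subseteq> P \<and> card X = t \<and> \<not> D \<subseteq> X}"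
  have fin\<A>: "finite \<A>" using finP by (simp add: \<A>_def)
  have "card \<A> \<le> card (\<Union>d\<in>D. {X. X \<subseteq> P - {d} \<and> card X = t})"
    using finP by (intro card_mono) (auto simp: \<A>_def D_def)
  also have "\<dots> \<le> (\<Sum>d\<in>D. card {X. X \<subseteq> P - {d} \<and> card X = t})"
    using finP by (intro card_UN_le) (simp add: D_def)
  also have "\<dots> = (\<Sum>d\<in>D. m choose t)"
    using finP cP by (intro sum.cong) (auto simp: n_subsets D_def)
  finally have c\<A>: "card \<A> \<le> (Suc m - t) * (m choose t)" by (simp add: cD)
  have "card \<T> \<le> card \<A> * (Suc m - t) ^ (m - t)"
  proof (rule card_covered_le[OF \<T>(1) fin\<A>])
    fix Q assume Q: "Q \<in> \<T>"
    then have Qk: "Q \<in> kpartitions (Suc m) A" using sub by blast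
    show "\<exists>X\<in>\<A>. X \<subseteq> Q"
    proof (cases "Q = P")
      case True
      \<comment> \<open>\<open>P\<close> itself contains \<open>P \<inter> C\<close>, which is
        disjoint from the nonempty \<open>D\<close>.\<close>
      have "D \<noteq> {}" using cD t by auto
      then have "P \<inter> C \<in> \<A>" using PC by (auto simp: \<A>_def D_def)
      then show ?thesis using True by blast
    next
      case False
      have "\<not> D \<subseteq> Q"
      proof
        assume DQ: "D \<subseteq> Q"
        \<comment> \<open>The block \<open>H\<close> of \<open>P\<close> through a point of
          \<open>E\<close> lies in \<open>C\<close> or in \<open>D \<subseteq> Q\<close>. Both
          partitions contain \<open>E\<close>, so \<open>H = E\<close> either way.\<close>
        have "Q \<inter> C \<subseteq> P \<inter> C"
        proof
          fix E assume E: "E \<in> Q \<inter> C"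
          then have "E \<noteq> {}" using kpartitionsD(4)[OF Qk] by blast
          then obtain p where p: "p \<in> E" by blast
          then have "p \<in> \<Union>P" using E kpartitionsD(3)[OF Qk] kpartitionsD(3)[OF Pk] by blast
          then obtain H where H: "H \<in> P" "p \<in> H" by blast
          have "H = E"
          proof (cases "H \<in> C")
            case True
            then show ?thesis using block_eq[OF Ck _ _ H(2) p] E by blast
          next
            case False
            then have "H \<in> Q" using H(1) DQ by (auto simp: D_def)
            then show ?thesis using block_eq[OF Qk _ _ H(2) p] E by blast
          qed
          then show "E \<in> P \<inter> C" using H(1) E by blast
        qed
        moreover have "card (P \<inter> C) \<le> card (Q \<inter> C)" using t_intD[OF \<T>(2) Q C(1)] PC by simp
        ultimately have "Q \<inter> C = P \<inter> C" using finP by (intro card_seteq) auto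
        then have "P \<subseteq> Q" using DQ by (auto simp: D_def)
        then have "P = Q" by (rule kpartition_subset_eq[OF A Qk _ cP])
        with False show False by simp
      qed
      obtain X where X: "X \<subseteq> Q \<inter> P" "card X = t"
        using obtain_subset_with_card_n[OF t_intD[OF \<T>(2) Q P]] by metis
      then have "X \<in> \<A>" using \<open>\<not> D \<subseteq> Q\<close> by (auto simp: \<A>_def)
      then show ?thesis using X(1) by blast
    qed
  next
    fix X assume "X \<in> \<A>"
    then have X: "finite X" "card X = t" using finP finite_subset by (auto simp: \<A>_def)
    have "\<T> \<inter> kpartitions (Suc m) A = \<T>" using sub by blast
    moreover have "\<exists>P\<in>kpartitions (Suc m) A. T \<subseteq> P" if "T \<in> \<T>" for T using sub that by blast
    ultimately show "card {T \<in> \<T>. X \<subseteq> T} \<le> (Suc m - t) ^ (m - t)"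
      using card_kpartitions_superfamily_le[OF A \<T> _ X t] by metis
  qed
  also have "\<dots> \<le> (Suc m - t) * (m choose t) * (Suc m - t) ^ (m - t)"
    by (intro mult_right_mono c\<A>) simp
  finally show ?thesis .
qed simp

text \<open>Although all members of \<open>\<R>\<close> contain \<open>X\<close>, a set
  \<open>C\<close> they all meet does not. Hence each of them contains one of \<open>i + 1\<close>
  elements of \<open>C - X\<close>, which prescribes a block beyond the \<open>t\<close> blocks of
  \<open>X\<close>.\<close>

lemma card_covered_star_le:
  assumes A: "finite A" and X: "finite X" "card X = t" "\<And>T. T \<in> \<R> \<Longrightarrow> X \<subseteq> T"
    and C: "finite C" "card C \<le> t + i" "\<not> X \<subseteq> C" "\<And>T. T \<in> \<R> \<Longrightarrow> t \<le> card (T \<inter> C)"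
    and k: "t + 1 < k"
  shows "card (covered k A \<R>) \<le> (i + 1) * Stirling (card A - t - 1) (k - t - 1)"
proof -
  have "X \<inter> C \<subset> X" using C(3) by blast
  then have lt: "card (X \<inter> C) < t" using psubset_card_mono[OF X(1)] X(2) by blast
  have "card (C - X) + card (X \<inter> C) < (i + 1) + t"
    using card_Int_Diff[OF C(1), of X] C(2) by (simp add: Int_commute)
  then obtain W where W: "W \<subseteq> C - X" "card W \<le> i + 1"
    "\<And>T. t \<le> card (T \<inter> C) \<Longrightarrow> T \<inter> C \<subseteq> X \<union> (C - X) \<Longrightarrow> T \<inter> W \<noteq> {}"
    using hitting_subset[OF C(1) finite_Diff[OF C(1)] lt] by metis
  have finW: "finite W" using W(1) C(1) finite_subset by blast
  have "covered k A \<R> \<subseteq> (\<Union>w\<in>W. {P \<in> kpartitions k A. insert w X \<subseteq> P})"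
  proof
    fix P assume "P \<in> covered k A \<R>"
    then obtain T where T: "P \<in> kpartitions k A" "T \<in> \<R>" "T \<subseteq> P" by (auto simp: covered_def)
    have "T \<inter> W \<noteq> {}" using W(3)[OF C(4)[OF T(2)]] by blast
    then obtain w where "w \<in> T" "w \<in> W" by blast
    then show "P \<in> (\<Union>w\<in>W. {P \<in> kpartitions k A. insert w X \<subseteq> P})"
      using T X(3)[OF T(2)] by blast
  qed
  then have "card (covered k A \<R>) \<le> card (\<Union>w\<in>W. {P \<in> kpartitions k A. insert w X \<subseteq> P})"
    using finW finite_kpartitions[OF A] by (intro card_mono) auto
  also have "\<dots> \<le> (\<Sum>w\<in>W. card {P \<in> kpartitions k A. insert w X \<subseteq> P})"
    by (rule card_UN_le[OF finW])
  also have "\<dots> \<le> (\<Sum>w\<in>W. Stirling (card A - t - 1) (k - t - 1))"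
  proof (rule sum_mono)
    fix w assume "w \<in> W"
    then have "card (insert w X) = Suc t" using W(1) X(1,2) by (subst card_insert_disjoint) auto
    then show "card {P \<in> kpartitions k A. insert w X \<subseteq> P} \<le> Stirling (card A - t - 1) (k - t - 1)"
      using card_superfamily_le[OF A, of "insert w X" k] X(1) k by simp
  qed
  also have "\<dots> \<le> (i + 1) * Stirling (card A - t - 1) (k - t - 1)"
    using mult_right_mono[OF W(2)] by simp
  finally show ?thesis .
qed

section \<open>The geometric series bound\<close>

context
  fixes A :: "'a set" and k t :: nat and S :: real
  assumes A: "finite A" and t: "1 \<le> t" "t + 2 \<le> k" and S: "S \<ge> 0"
    and ratio: "\<And>i. i < k - t \<Longrightarrow>
      real (Stirling (card A - t - i) (k - t - i)) * (2 * exp 1 * real k) ^ i \<le> S"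
begin

text \<open>Bounds what is left over when the remaining members share \<open>t\<close> blocks:
  \<open>ratio\<close> at 1 gains \<open>2 e k\<close>, and \<open>e \<ge> 2\<close>.\<close>

lemma star_rest_le:
  assumes "i + 1 \<le> k"
  shows "real ((i + 1) * Stirling (card A - t - 1) (k - t - 1)) \<le> S / 4"
proof -
  let ?s = "real (Stirling (card A - t - 1) (k - t - 1))"
  have e: "2 \<le> exp (1 :: real)" using exp_ge_add_one_self[of 1] by simp
  have "4 * (real (i + 1) * ?s) \<le> (2 * exp 1) * (real k * ?s)"
    using e assms by (intro mult_mono) auto
  also have "\<dots> \<le> S" using ratio[of 1] t by (simp add: mult_ac)
  finally show ?thesis by (simp only: of_nat_mult)
qed

text \<open>Induction on the excess \<open>i\<close> over \<open>t\<close>. After saturation the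
  members of largest size cover at most \<open>(1 / 2) ^ i * S\<close> partitions. The rest is
  smaller, and either the induction hypothesis applies or it has \<open>t\<close> common blocks and
  covers at most \<open>S / 4\<close>.\<close>

lemma card_covered_nontrivial_le:
  assumes "i < k - t" "finite \<T>" "\<And>T. T \<in> \<T> \<Longrightarrow> finite T" "t_int t \<T>"
    "\<And>T. T \<in> \<T> \<Longrightarrow> card T \<le> t + i" "nontrivial t \<T>"
  shows "real (card (covered k A \<T>)) \<le> (1 - (1 / 2) ^ i) * S"
  using assms
proof (induction i arbitrary: \<T>)
  case 0
  have "\<T> = {}"
  proof (rule ccontr)
    assume "\<T> \<noteq> {}"
    then obtain T where T: "T \<in> \<T>" by blast
    \<comment> \<open>Any two members share \<open>t\<close> elements, so a member of size
      \<open>t\<close> would be a common subset of all of them.\<close>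
    have cT: "card T = t" using t_int_card[OF 0(4) T] 0(5)[OF T] by simp
    then obtain T' where T': "T' \<in> \<T>" "\<not> T \<subseteq> T'"
      using 0(6) 0(3)[OF T] unfolding nontrivial_def by blast
    have "T \<inter> T' \<subset> T" using T'(2) by blast
    then have "card (T \<inter> T') < t" using psubset_card_mono[OF 0(3)[OF T]] cT by blast
    then show False using t_intD[OF 0(4) T T'(1)] by simp
  qed
  then show ?case by (simp add: covered_def)
next
  case (Suc i)
  obtain \<S> where \<S>: "finite \<S>" "t_int t \<S>" "saturated t \<S>"
    "\<And>T. T \<in> \<T> \<Longrightarrow> \<exists>S\<in>\<S>. S \<subseteq> T" "\<And>S. S \<in> \<S> \<Longrightarrow> \<exists>T\<in>\<T>. S \<subseteq> T"
    using saturated_refinement[OF Suc.prems(2-4)] by metis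
  have fin: "finite S" and le: "card S \<le> t + Suc i" if S: "S \<in> \<S>" for S
  proof -
    obtain T where T: "T \<in> \<T>" "S \<subseteq> T" using \<S>(5)[OF S] by blast
    show "finite S" using T Suc.prems(3) finite_subset by metis
    show "card S \<le> t + Suc i"
      using card_mono[OF Suc.prems(3)[OF T(1)] T(2)] Suc.prems(5)[OF T(1)] by simp
  qed
  have nt: "nontrivial t \<S>" by (rule nontrivial_refine[OF Suc.prems(6) \<S>(4)])
  define W where "W = {T \<in> \<S>. card T = t + Suc i}"
  define R where "R = \<S> - W"
  have finW: "finite W" using \<S>(1) by (simp add: W_def)
  have "covered k A \<T> \<subseteq> (\<Union>T\<in>W. {P \<in> kpartitions k A. T \<subseteq> P}) \<union> covered k A R"
  proof
    fix P assume "P \<in> covered k A \<T>"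
    then obtain T where T: "P \<in> kpartitions k A" "T \<in> \<T>" "T \<subseteq> P" by (auto simp: covered_def)
    obtain S where S: "S \<in> \<S>" "S \<subseteq> T" using \<S>(4)[OF T(2)] by blast
    then have "S \<subseteq> P" "S \<in> W \<or> S \<in> R" using T(3) by (auto simp: R_def)
    then show "P \<in> (\<Union>T\<in>W. {P \<in> kpartitions k A. T \<subseteq> P}) \<union> covered k A R"
      using T(1) by (auto simp: covered_def)
  qed
  then have "card (covered k A \<T>)
      \<le> card ((\<Union>T\<in>W. {P \<in> kpartitions k A. T \<subseteq> P}) \<union> covered k A R)"
    using finW finite_kpartitions[OF A] finite_covered[OF A] by (intro card_mono) auto
  also have "\<dots> \<le> card (\<Union>T\<in>W. {P \<in> kpartitions k A. T \<subseteq> P}) + card (covered k A R)"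
    by (rule card_Un_le)
  finally have split: "card (covered k A \<T>)
    \<le> card (\<Union>T\<in>W. {P \<in> kpartitions k A. T \<subseteq> P}) + card (covered k A R)" .
  let ?s = "Stirling (card A - t - Suc i) (k - t - Suc i)"
  have "card (\<Union>T\<in>W. {P \<in> kpartitions k A. T \<subseteq> P})
      \<le> (\<Sum>T\<in>W. card {P \<in> kpartitions k A. T \<subseteq> P})"
    by (rule card_UN_le[OF finW])
  also have "\<dots> \<le> (\<Sum>T\<in>W. ?s)"
  proof (rule sum_mono)
    fix T assume "T \<in> W"
    then have T: "finite T" "card T = t + Suc i" using fin by (auto simp: W_def)
    have "card T < k" using T(2) Suc.prems(1) by simp
    from card_superfamily_le[OF A T(1) this]
    show "card {P \<in> kpartitions k A. T \<subseteq> P} \<le> ?s" by (simp add: T(2))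
  qed
  also have "\<dots> = card W * ?s" by simp
  also have "\<dots> \<le> (t + Suc i choose t) * (Suc i + 1) ^ Suc i * ?s"
    unfolding W_def by (intro mult_right_mono card_top_level_le[OF \<S>(1) fin \<S>(2,3) le]) auto
  finally have "real (card (\<Union>T\<in>W. {P \<in> kpartitions k A. T \<subseteq> P}))
      \<le> real (t + Suc i choose t) * real (Suc i + 1) ^ Suc i * real ?s"
    by (simp only: of_nat_le_iff flip: of_nat_mult of_nat_power)
  also have "\<dots> \<le> (exp 1 * real (t + Suc i)) ^ Suc i * real ?s"
  proof -
    have "t + Suc i choose t = t + Suc i choose Suc i"
      using binomial_symmetric[of t "t + Suc i"] by simp
    then show ?thesis using choose_mult_Suc_power_le[of "t + Suc i" "Suc i"]
      by (intro mult_right_mono) auto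
  qed
  also have "\<dots> \<le> (exp 1 * real k) ^ Suc i * real ?s"
    using Suc.prems(1) by (intro mult_right_mono power_mono mult_left_mono) auto
  also have "\<dots> = (1 / 2) ^ Suc i * (real ?s * (2 * exp 1 * real k) ^ Suc i)"
    by (simp add: power_mult_distrib power_divide)
  also have "\<dots> \<le> (1 / 2) ^ Suc i * S"
    by (intro mult_left_mono ratio Suc.prems(1)) simp
  finally have W_le: "real (card (\<Union>T\<in>W. {P \<in> kpartitions k A. T \<subseteq> P})) \<le> (1 / 2) ^ Suc i * S" .
  have R_le: "real (card (covered k A R)) \<le> (1 - 2 * (1 / 2) ^ Suc i) * S"
  proof (cases "nontrivial t R")
    case True
    have "real (card (covered k A R)) \<le> (1 - (1 / 2) ^ i) * S"
    proof (rule Suc.IH)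
      show "t_int t R" using t_int_subset[OF \<S>(2)] by (auto simp: R_def)
      show "card T \<le> t + i" if "T \<in> R" for T using le[of T] that by (auto simp: R_def W_def)
    qed (use Suc.prems(1) \<S>(1) fin True in \<open>auto simp: R_def\<close>)
    then show ?thesis by simp
  next
    case False
    then obtain X where X: "finite X" "card X = t" "\<And>T. T \<in> R \<Longrightarrow> X \<subseteq> T"
      unfolding nontrivial_def by blast
    obtain C where C: "C \<in> \<S>" "\<not> X \<subseteq> C" using nt X(1,2) unfolding nontrivial_def by blast
    show ?thesis
    proof (cases "i = 0")
      case True
      \<comment> \<open>For \<open>i = 0\<close> the bound to be shown is 0. A member of
        \<open>R\<close> has size \<open>t\<close> and thus equals \<open>X\<close>, but then it
        meets \<open>C\<close> in fewer than \<open>t\<close> elements.\<close>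
      have "R = {}"
      proof (rule ccontr)
        assume "R \<noteq> {}"
        then obtain T where T: "T \<in> R" by blast
        then have TS: "T \<in> \<S>" and "card T \<noteq> t + 1" using True by (auto simp: R_def W_def)
        then have "card T = t" using le[OF TS] t_int_card[OF \<S>(2) TS] True by simp
        then have TX: "T = X" using X(2) card_subset_eq[OF fin[OF TS] X(3)[OF T]] by simp
        have "T \<inter> C \<subset> T" using C(2) TX by blast
        then have "card (T \<inter> C) < t"
          using psubset_card_mono[OF fin[OF TS]] \<open>card T = t\<close> by blast
        then show False using t_intD[OF \<S>(2) TS C(1)] by simp
      qed
      then show ?thesis using True by (simp add: covered_def)
    next
      case False
      have "card (covered k A R) \<le> (Suc i + 1) * Stirling (card A - t - 1) (k - t - 1)"
      proof (rule card_covered_star_le[OF A X _ _ C(2)])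
        show "t \<le> card (T \<inter> C)" if "T \<in> R" for T
          using that t_intD[OF \<S>(2) _ C(1)] by (auto simp: R_def)
      qed (use fin[OF C(1)] le[OF C(1)] t in auto)
      then have "real (card (covered k A R))
          \<le> real ((Suc i + 1) * Stirling (card A - t - 1) (k - t - 1))"
        by (simp only: of_nat_le_iff)
      also have "\<dots> \<le> S / 4" using Suc.prems(1) by (intro star_rest_le) simp
      \<comment> \<open>For \<open>i \<ge> 1\<close> the factor on the right is at least
        1/2.\<close>
      also have "\<dots> \<le> (1 - 2 * (1 / 2) ^ Suc i) * S"
      proof -
        have "(1 / 2 :: real) ^ i \<le> (1 / 2) ^ 1" using False by (intro power_decreasing) auto
        then have "(1 / 4) * S \<le> (1 - 2 * (1 / 2) ^ Suc i) * S"
          using S by (intro mult_right_mono) auto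
        then show ?thesis by simp
      qed
      finally show ?thesis .
    qed
  qed
  have "real (card (covered k A \<T>))
      \<le> real (card (\<Union>T\<in>W. {P \<in> kpartitions k A. T \<subseteq> P})) + real (card (covered k A R))"
    using split by simp
  also have "\<dots> \<le> (1 / 2) ^ Suc i * S + (1 - 2 * (1 / 2) ^ Suc i) * S"
    by (intro add_mono W_le R_le)
  also have "\<dots> = (1 - (1 / 2) ^ Suc i) * S" by (simp add: algebra_simps)
  finally show ?case .
qed

text \<open>After saturation, \<open>W\<close> collects the members that are full partitions; all
  others have at most \<open>m = k - 1\<close> blocks. If there are others, \<open>W\<close>
  accounts for less than \<open>(1 / 2) ^ (m - t) * S\<close> and the rest for the remainder of
  \<open>S\<close>. If not, the sharper count for families of full partitions suffices.\<close>

lemma card_nontrivial_less: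
  assumes F: "F \<subseteq> kpartitions k A" "t_int t F" "nontrivial t F" and kA: "k \<le> card A"
  shows "real (card F) < S"
proof -
  define m where "m = k - 1"
  have km: "k = Suc m" and tm: "t < m" using t by (auto simp: m_def)
  have finF: "finite F" "\<And>P. P \<in> F \<Longrightarrow> finite P"
    using F(1) finite_kpartitions[OF A] finite_kpartition[OF A] finite_subset by blast+
  obtain \<S> where \<S>: "finite \<S>" "t_int t \<S>" "saturated t \<S>"
    "\<And>T. T \<in> F \<Longrightarrow> \<exists>S\<in>\<S>. S \<subseteq> T" "\<And>S. S \<in> \<S> \<Longrightarrow> \<exists>T\<in>F. S \<subseteq> T"
    using saturated_refinement[OF finF F(2)] by metis
  have sub: "\<exists>P\<in>kpartitions (Suc m) A. T \<subseteq> P" if "T \<in> \<S>" for T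
    using \<S>(5)[OF that] F(1) km by blast
  have fin: "finite T" and le: "card T \<le> Suc m" if T: "T \<in> \<S>" for T
  proof -
    obtain P where P: "P \<in> kpartitions (Suc m) A" "T \<subseteq> P" using sub[OF T] by blast
    show "finite T" using finite_subset[OF P(2) finite_kpartition[OF A P(1)]] .
    show "card T \<le> Suc m"
      using card_mono[OF finite_kpartition[OF A P(1)] P(2)] kpartitionsD(2)[OF P(1)] by simp
  qed
  have nt: "nontrivial t \<S>" by (rule nontrivial_refine[OF F(3) \<S>(4)])
  define W where "W = \<S> \<inter> kpartitions (Suc m) A"
  define R where "R = \<S> - W"
  have R_card: "card T \<le> m" if T: "T \<in> R" for T
  proof -
    have TS: "T \<in> \<S>" and "T \<notin> kpartitions (Suc m) A" using T by (auto simp: R_def W_def)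
    then have "card T \<noteq> Suc m" using sub[OF TS] kpartition_subset_eq[OF A] by metis
    with le[OF TS] show ?thesis by simp
  qed
  have "F \<subseteq> W \<union> covered k A R"
  proof
    fix P assume P: "P \<in> F"
    then obtain T where T: "T \<in> \<S>" "T \<subseteq> P" using \<S>(4) by blast
    have Pk: "P \<in> kpartitions (Suc m) A" using P F(1) km by blast
    show "P \<in> W \<union> covered k A R"
    proof (cases "T \<in> W")
      case True
      then have "card T = Suc m" using kpartitionsD(2) by (auto simp: W_def)
      then have "T = P" by (rule kpartition_subset_eq[OF A Pk T(2)])
      with True show ?thesis by simp
    next
      case False
      then show ?thesis using T Pk by (auto simp: covered_def R_def km)
    qed
  qed
  then have "card F \<le> card (W \<union> covered k A R)"
    using \<S>(1) finite_covered[OF A] by (intro card_mono) (auto simp: W_def)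
  also have "\<dots> \<le> card W + card (covered k A R)" by (rule card_Un_le)
  finally have split: "real (card F) \<le> real (card W) + real (card (covered k A R))" by simp
  define q where "q = (exp 1 * real k) ^ (m - t)"
  \<comment> \<open>For \<open>i = m - t\<close> this is the product in
    \<open>choose_mult_Suc_power_le\<close>. The base there is \<open>m\<close>, and
    \<open>m < k\<close> makes the comparison with \<open>q\<close> strict.\<close>
  have "real (m choose t) * real (Suc m - t) ^ (m - t)
      = real (m choose (m - t)) * real (m - t + 1) ^ (m - t)"
    using binomial_symmetric[of t m] tm by (simp add: Suc_diff_le)
  also have "\<dots> \<le> (exp 1 * real m) ^ (m - t)" by (rule choose_mult_Suc_power_le)
  also have "\<dots> < q"
    unfolding q_def km using tm by (intro power_strict_mono) auto
  finally have start: "real (m choose t) * real (Suc m - t) ^ (m - t) < q" .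
  \<comment> \<open>At \<open>i = m - t\<close> a single block remains, so the Stirling number in
    \<open>ratio\<close> is 1 and only the power of \<open>2 e k\<close> is left.\<close>
  have "card A - t - (m - t) = Suc (card A - k)" "k - t - (m - t) = Suc 0" "m - t < k - t"
    using kA tm km by auto
  then have "real (Stirling (card A - t - (m - t)) (k - t - (m - t))) = 1" and i: "m - t < k - t"
    by (simp_all only: Stirling_1 of_nat_1)
  then have qS: "2 ^ (m - t) * q \<le> S"
    using ratio[OF i] by (simp only: q_def power_mult_distrib mult.assoc mult_1)
  show ?thesis
  proof (cases "R = {}")
    case True
    then have "\<S> \<subseteq> kpartitions (Suc m) A" by (auto simp: R_def W_def)
    from card_saturated_kpartitions_le[OF A \<S>(1-3) this] tm
    have "card \<S> \<le> (Suc m - t) * ((m choose t) * (Suc m - t) ^ (m - t))"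
      by (simp add: mult.assoc)
    \<comment> \<open>The power of 2 contained in \<open>qS\<close> absorbs the additional factor
      \<open>Suc m - t\<close>.\<close>
    moreover have "Suc m - t \<le> 2 ^ (m - t)"
      using less_exp[of "m - t"] tm by (simp add: Suc_diff_le Suc_le_eq)
    ultimately have "card \<S> \<le> 2 ^ (m - t) * ((m choose t) * (Suc m - t) ^ (m - t))"
      using mult_right_mono le_trans by blast
    then have "real (card \<S>) \<le> real (2 ^ (m - t) * ((m choose t) * (Suc m - t) ^ (m - t)))"
      by (simp only: of_nat_le_iff)
    also have "\<dots> = 2 ^ (m - t) * (real (m choose t) * real (Suc m - t) ^ (m - t))" by simp
    also have "\<dots> < 2 ^ (m - t) * q" using start by simp
    also note qS
    finally have "real (card \<S>) < S" .
    moreover have "W = \<S>" using True by (auto simp: R_def W_def)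
    ultimately show ?thesis using split True by (simp add: covered_def)
  next
    case False
    then obtain C where C: "C \<in> R" by blast
    then have "C \<in> \<S>" by (simp add: R_def)
    from card_kpartitions_in_saturated_le[OF A \<S>(1-3) sub _ this fin[OF this] R_card[OF C]] tm
    have "card W \<le> (m choose t) * (Suc m - t) ^ (m - t)" by (simp add: W_def)
    then have "real (card W) \<le> real ((m choose t) * (Suc m - t) ^ (m - t))"
      by (simp only: of_nat_le_iff)
    also have "\<dots> = real (m choose t) * real (Suc m - t) ^ (m - t)" by simp
    also note start
    also have "q \<le> (1 / 2) ^ (m - t) * S"
      using qS by (simp add: power_divide field_simps)
    finally have W_less: "real (card W) < (1 / 2) ^ (m - t) * S" .
    have R_le: "real (card (covered k A R)) \<le> (1 - (1 / 2) ^ (m - t)) * S"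
    proof (cases "nontrivial t R")
      case True
      then show ?thesis
      proof (intro card_covered_nontrivial_le)
        show "t_int t R" using t_int_subset[OF \<S>(2)] by (auto simp: R_def)
        show "card T \<le> t + (m - t)" if "T \<in> R" for T using R_card[OF that] tm by simp
      qed (use km tm \<S>(1) fin in \<open>auto simp: R_def\<close>)
    next
      case False
      then obtain X where X: "finite X" "card X = t" "\<And>T. T \<in> R \<Longrightarrow> X \<subseteq> T"
        unfolding nontrivial_def by blast
      obtain C where C: "C \<in> \<S>" "\<not> X \<subseteq> C" using nt X(1,2) unfolding nontrivial_def by blast
      have "card (covered k A R) \<le> (k - t + 1) * Stirling (card A - t - 1) (k - t - 1)"
      proof (rule card_covered_star_le[OF A X _ _ C(2)])
        show "t \<le> card (T \<inter> C)" if "T \<in> R" for T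
          using that t_intD[OF \<S>(2) _ C(1)] by (auto simp: R_def)
      qed (use fin[OF C(1)] le[OF C(1)] km t in auto)
      then have "real (card (covered k A R))
          \<le> real ((k - t + 1) * Stirling (card A - t - 1) (k - t - 1))"
        by (simp only: of_nat_le_iff)
      also have "\<dots> \<le> S / 4" using t by (intro star_rest_le) simp
      also have "\<dots> \<le> (1 - (1 / 2) ^ (m - t)) * S"
      proof -
        have "(1 / 2 :: real) ^ (m - t) \<le> (1 / 2) ^ 1" using tm by (intro power_decreasing) auto
        then have "(1 / 4) * S \<le> (1 - (1 / 2) ^ (m - t)) * S"
          using S by (intro mult_right_mono) auto
        then show ?thesis by simp
      qed
      finally show ?thesis .
    qed
    have "real (card F) < (1 / 2) ^ (m - t) * S + (1 - (1 / 2) ^ (m - t)) * S"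
      using split W_less R_le by linarith
    then show ?thesis by (simp add: algebra_simps)
  qed
qed

end

section \<open>The equality case and the theorem\<close>

lemma card_superfamily_singletons:
  assumes A: "finite A" and X: "finite X" "\<And>B. B \<in> X \<Longrightarrow> card B = 1"
    and P: "P \<in> kpartitions k A" "X \<subseteq> P"
  obtains T where "T \<subseteq> A" "card T = card X"
    "singleton_star k A T = {P \<in> kpartitions k A. X \<subseteq> P}"
proof -
  define T where "T = {x. {x} \<in> X}"
  have X_eq: "X = (\<lambda>x. {x}) ` T"
  proof
    show "X \<subseteq> (\<lambda>x. {x}) ` T"
    proof
      fix B assume B: "B \<in> X"
      then obtain x where "B = {x}" using X(2) card_1_singletonE by metis
      with B show "B \<in> (\<lambda>x. {x}) ` T" by (simp add: T_def)
    qed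
  qed (auto simp: T_def)
  have "card X = card T" unfolding X_eq by (simp add: card_image inj_on_def)
  moreover have "T \<subseteq> A" using P kpartitionsD(3)[OF P(1)] by (auto simp: T_def)
  moreover have "singleton_star k A T = {P \<in> kpartitions k A. X \<subseteq> P}"
    unfolding X_eq by (auto simp: singleton_star_def)
  ultimately show thesis using that by metis
qed

theorem theorem5p2:
  fixes n k t :: nat and F :: "nat set set set"
  assumes "t \<ge> 1" and "k \<ge> t + 2"
    and "F \<subseteq> kpartitions k {1..n}"
    and "t_intersecting t F"
    and "real n \<ge> real t + 1 + (real k - real t - 1) * log 2 (2 * exp 1 * real k + 1)"
  shows "card F \<le> Stirling (n - t) (k - t) \<and>
    (card F = Stirling (n - t) (k - t) \<longleftrightarrow>
      (\<exists>T. T \<subseteq> {1..n} \<and> card T = t \<and> F = singleton_star k {1..n} T))"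
proof -
  let ?A = "{1..n}" and ?S = "Stirling (n - t) (k - t)" and ?c = "2 * exp 1 * real k"
  have A: "finite ?A" "card ?A = n" by simp_all
  \<comment> \<open>From \<open>1 \<le> ?c\<close> the logarithm is at least 1, so the lower bound
    on \<open>n\<close> yields \<open>k \<le> n\<close>.\<close>
  have "2 * 1 * 1 \<le> ?c"
    using assms(2) exp_ge_add_one_self[of 1] by (intro mult_mono) auto
  then have c: "1 \<le> ?c" by simp
  then have "1 \<le> log 2 (?c + 1)" by simp
  then have "(real k - real t - 1) * 1 \<le> (real k - real t - 1) * log 2 (?c + 1)"
    using assms(2) by (intro mult_left_mono) auto
  then have "real k \<le> real n" using assms(5) by simp
  then have kn: "k \<le> n" by simp
  \<comment> \<open>Moving \<open>t\<close> to the other side turns the lower bound on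
    \<open>n\<close> into the hypothesis of \<open>Stirling_diff_ge\<close> for \<open>n - t\<close>
    and \<open>k - t\<close>.\<close>
  have "real (k - t - 1) = real k - real t - 1" using assms(2) by simp
  then have "real (k - t - 1) * log 2 (?c + 1) + 1 \<le> real (n - t)"
    using assms(2,5) kn by (simp only: of_nat_diff)
  note ratio = Stirling_diff_ge[OF this c]
  have Spos: "0 < ?S" using assms(2) kn by (intro Stirling_pos) auto
  \<comment> \<open>A member meets itself in \<open>k \<ge> t\<close> blocks; distinct members are
    handled by \<open>t_intersecting\<close>.\<close>
  have tint: "t_int t F"
    unfolding t_int_def
  proof (intro ballI)
    fix P Q assume PQ: "P \<in> F" "Q \<in> F"
    show "t \<le> card (P \<inter> Q)"
    proof (cases "P = Q")
      case True
      then show ?thesis using PQ assms(2,3) kpartitionsD(2)[of P k ?A] by auto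
    next
      case False
      then show ?thesis using PQ assms(4) by (auto simp: t_intersecting_def pairwise_def)
    qed
  qed
  have "card F \<le> ?S \<and> (card F = ?S \<longrightarrow>
      (\<exists>T. T \<subseteq> ?A \<and> card T = t \<and> F = singleton_star k ?A T))"
  proof (cases "nontrivial t F")
    case True
    have "real (card F) < real ?S"
      using card_nontrivial_less[OF A(1) assms(1,2) _ _ assms(3) tint True, of "real ?S"] ratio A(2) kn
      by simp
    then show ?thesis by simp
  next
    case False
    then obtain X where X: "finite X" "card X = t" "\<And>P. P \<in> F \<Longrightarrow> X \<subseteq> P"
      unfolding nontrivial_def by blast
    let ?X = "{P \<in> kpartitions k ?A. X \<subseteq> P}"
    have FX: "F \<subseteq> ?X" using X(3) assms(3) by blast
    have finX: "finite ?X" using finite_kpartitions[OF A(1)] by simp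
    have cF: "card F \<le> card ?X" by (rule card_mono[OF finX FX])
    have cX: "card ?X \<le> ?S"
      using card_superfamily_le[OF A(1) X(1), of k] X(2) A(2) assms(2) by simp
    have "\<exists>T. T \<subseteq> ?A \<and> card T = t \<and> F = singleton_star k ?A T" if eq: "card F = ?S"
    proof -
      \<comment> \<open>Equality makes \<open>F\<close> the set of all partitions containing
        \<open>X\<close>. A non-singleton in \<open>X\<close> would make the bound strict, so
        \<open>X\<close> consists of singletons.\<close>
      have "F \<noteq> {}" using eq Spos by auto
      then obtain P where P: "P \<in> F" by blast
      have "F = ?X" using card_subset_eq[OF finX FX] eq cF cX by simp
      moreover have "card B = 1" if "B \<in> X" for B
      proof (rule ccontr)
        assume "card B \<noteq> 1"
        from card_superfamily_less[OF A(1) X(1) _ _ that this, of k]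
        have "card ?X < ?S" using X(2) A(2) assms(2) kn by simp
        then show False using eq cF by simp
      qed
      then obtain T where "T \<subseteq> ?A" "card T = card X" "singleton_star k ?A T = ?X"
        using card_superfamily_singletons[OF A(1) X(1) _ _ X(3)[OF P]] P assms(3) by blast
      ultimately show ?thesis using X(2) by blast
    qed
    then show ?thesis using cF cX by simp
  qed
  moreover have "card F = ?S" if "T \<subseteq> ?A" "card T = t" "F = singleton_star k ?A T" for T
    using card_singleton_star[OF A(1) that(1), of k] that(2,3) A(2) assms(2) by simp
  ultimately show ?thesis by blast
qed

end
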